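(* Let $G$ be a graph with $\alpha(G)=2$ and $\theta_f(G)\le 124/33$. Then every inflation $G'$ of $G$ with $\alpha(G')=2$ satisfies $\mathrm{had}(G')\ge\chi(G')$.
   Context: All graphs are finite and simple. $\theta_f(G)$, the fractional clique covering number of $G$, is the fractional chromatic number $\chi_f(\overline{G})=\inf_b \chi_b(\overline{G})/b$ of the complement, where $\chi_b$ is the least number of colours in an assignment of $b$-element colour sets to vertices with adjacent vertices receiving disjoint sets. An inflation of a graph $H$ is obtained by choosing integers $c_x\ge 0$ for $x\in V(H)$, replacing each $x$ by a clique $C_x$ of order $c_x$, with every vertex of $C_x$ adjacent to every vertex of $C_y$ ($x\neq y$) if $xy\in E(H)$ and no edges between them otherwise. $\mathrm{had}(G)$ is the largest $t$ such that $K_t$ is a minor of $G$. *)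

theory Defs
  imports Complex_Main "HOL-Library.Disjoint_Sets" "Graph_Theory.Graph_Theory"
begin

text \<open>
  Finite simple graphs are the library's \<^locale>\<open>pair_graph\<close>: finitely many vertices and a
  symmetric irreflexive arc relation, an edge \<open>uv\<close> being the two arcs \<open>(u, v)\<close> and \<open>(v, u)\<close>.
\<close>

definition complement_graph :: "'a pair_pre_digraph \<Rightarrow> 'a pair_pre_digraph" where
  "complement_graph G =
     \<lparr> pverts = pverts G,
       parcs = {(u, v). u \<in> pverts G \<and> v \<in> pverts G \<and> u \<noteq> v \<and> (u, v) \<notin> parcs G} \<rparr>"

definition complete_graph :: "nat \<Rightarrow> nat pair_pre_digraph" where
  "complete_graph t =
     \<lparr> pverts = {..<t}, parcs = {(i, j). i < t \<and> j < t \<and> i \<noteq> j} \<rparr>"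

definition independent_set :: "'a pair_pre_digraph \<Rightarrow> 'a set \<Rightarrow> bool" where
  "independent_set G S \<longleftrightarrow> S \<subseteq> pverts G \<and> (\<forall>u\<in>S. \<forall>v\<in>S. (u, v) \<notin> parcs G)"

definition independence_number :: "'a pair_pre_digraph \<Rightarrow> nat" where
  "independence_number G = Max {card S | S. independent_set G S}"

definition proper_colouring :: "'a pair_pre_digraph \<Rightarrow> nat \<Rightarrow> ('a \<Rightarrow> nat) \<Rightarrow> bool" where
  "proper_colouring G k f \<longleftrightarrow>
     (\<forall>v\<in>pverts G. f v < k) \<and> (\<forall>(u, v)\<in>parcs G. f u \<noteq> f v)"

definition chromatic_number :: "'a pair_pre_digraph \<Rightarrow> nat" where
  "chromatic_number G = (LEAST k. \<exists>f. proper_colouring G k f)"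

definition b_fold_colouring ::
  "'a pair_pre_digraph \<Rightarrow> nat \<Rightarrow> nat \<Rightarrow> ('a \<Rightarrow> nat set) \<Rightarrow> bool" where
  "b_fold_colouring G b k F \<longleftrightarrow>
     (\<forall>v\<in>pverts G. F v \<subseteq> {..<k} \<and> card (F v) = b) \<and>
     (\<forall>(u, v)\<in>parcs G. F u \<inter> F v = {})"

definition b_fold_chromatic_number :: "nat \<Rightarrow> 'a pair_pre_digraph \<Rightarrow> nat" where
  "b_fold_chromatic_number b G = (LEAST k. \<exists>F. b_fold_colouring G b k F)"

definition fractional_chromatic_number :: "'a pair_pre_digraph \<Rightarrow> real" where
  "fractional_chromatic_number G =
     (INF b\<in>{1..}. real (b_fold_chromatic_number b G) / real b)"

definition fractional_clique_covering_number :: "'a pair_pre_digraph \<Rightarrow> real" where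
  "fractional_clique_covering_number G = fractional_chromatic_number (complement_graph G)"

text \<open>
  \<open>G'\<close> is an inflation of \<open>H\<close>, with \<open>C x\<close> the clique replacing the vertex \<open>x\<close> and \<open>c\<^sub>x = card (C x)\<close>;
  \<open>C x\<close> may be empty. The vertices of \<open>G'\<close> may have any type, so every isomorphic copy of an
  inflation counts as one.
\<close>

definition is_inflation :: "'a pair_pre_digraph \<Rightarrow> 'b pair_pre_digraph \<Rightarrow> bool" where
  "is_inflation H G' \<longleftrightarrow>
     (\<exists>C. (\<forall>x\<in>pverts H. finite (C x)) \<and>
          disjoint_family_on C (pverts H) \<and>
          pverts G' = (\<Union>x\<in>pverts H. C x) \<and>
          parcs G' = {(u, v). \<exists>x\<in>pverts H. \<exists>y\<in>pverts H. u \<in> C x \<and> v \<in> C y \<and>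
                        (x = y \<and> u \<noteq> v \<or> (x, y) \<in> parcs H)})"

text \<open>
  \<open>H\<close> is a minor of \<open>G\<close>, with \<open>B x\<close> the branch set contracted to the vertex \<open>x\<close>. The library's
  notion of connectedness, qualified here because of the topological one, excludes the empty graph,
  so branch sets are nonempty.
\<close>

definition is_minor :: "'b pair_pre_digraph \<Rightarrow> 'a pair_pre_digraph \<Rightarrow> bool" where
  "is_minor H G \<longleftrightarrow>
     (\<exists>B. (\<forall>x\<in>pverts H. B x \<subseteq> pverts G \<and>
              Digraph_Component.connected (with_proj G \<restriction> B x)) \<and>
          disjoint_family_on B (pverts H) \<and>
          (\<forall>(x, y)\<in>parcs H. \<exists>u\<in>B x. \<exists>v\<in>B y. (u, v) \<in> parcs G))"

definition hadwiger_number :: "'a pair_pre_digraph \<Rightarrow> nat" where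
  "hadwiger_number G = Max {t. is_minor (complete_graph t) G}"

end

theory Submission
  imports Defs
begin

text \<open>
  Let \<open>T\<close> be the complement of \<open>G'\<close>, a triangle-free graph with matching number \<open>\<nu>\<close> on \<open>n\<close> vertices.
  Colouring along a maximum matching gives \<open>\<chi>(G') \<le> n - \<nu>\<close>, so a clique minor of that order suffices.
  Vertices covered by all maximum matchings can be deleted, and a disconnected \<open>T\<close> splits \<open>G'\<close> into a
  join; by Gallai's lemma the remaining case is \<open>n = 2m + 1\<close>, \<open>\<nu> = m\<close>.

  Averaging over a fractional clique covering yields a clique of order at least \<open>33n/124\<close>, which
  together with the Ramsey bounds \<open>R(3,2)\<close>, \<dots>, \<open>R(3,5)\<close> for small \<open>n\<close> gives a maximum clique \<open>Z\<close>
  of order \<open>\<omega> \<ge> (m + 2)/2\<close>. Seagulls (induced three-vertex paths) are connected and dominating, so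
  it is enough to find \<open>m + 1 - \<omega>\<close> disjoint seagulls outside \<open>Z\<close>, following Chudnovsky and Seymour.
  If at most \<open>p\<close> disjoint seagulls exist in a graph on \<open>N \<ge> 3p + 3\<close> vertices without stable sets of
  size three, other than the five-wheel, then some \<open>N - 2p\<close> vertices span no seagull. In the case at
  hand this set would have more than \<open>\<omega>\<close> elements; but a set spanning no seagull is the union of two
  mutually nonadjacent cliques, each vertex of \<open>Z\<close> is complete to one of them, and so one of two
  cliques would be larger than \<open>Z\<close>.
\<close>

section \<open>Gulls in triangle-free graphs\<close>

text \<open>With n = 2m + 1 the required order (m + 2)/2 of a clique is (n + 3)/4, while averaging
  gives n divided by the fractional clique covering number. Any bound below 4 therefore settles all
  large n; for 124/33 = 4 - 8/33 this is so from m = 8 on. The same inequality m + 2 \<le> 2\<omega>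
  guarantees that p \<le> m - \<omega> gulls always leave at least three vertices outside
  \<open>Z\<close>.

  Most of the work is the packing statement. Its N - 2p vertices are the remainder of a maximum
  packing together with one vertex of each gull. The remainder spans no gull, so in the complement
  it is edgeless or complete bipartite. A single gull always has a vertex that fits such a
  remainder, apart from the five-wheel; the obstacle is that the choices in different gulls must
  also fit each other. Every conflict is turned into a better packing by repacking one or two gulls
  with the remainder, and for this a third vertex in the remainder is indispensable. The five-wheel
  is a true exception only when it is the whole graph: beside a further gull it always yields three
  disjoint gulls, which is why p = 1, N = 6 is all that has to be excluded.\<close>

text \<open>The relation \<open>t\<close> plays the role of nonadjacency in a graph without stable sets of size three.
  Accordingly a gull is a seagull (an induced path, with middle vertex \<open>b\<close>) seen in the complement.\<close>

locale triangle_free =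
  fixes t :: "'a \<Rightarrow> 'a \<Rightarrow> bool"
  assumes sym: "t u v \<Longrightarrow> t v u"
    and irrefl: "\<not> t u u"
    and triangle: "t u v \<Longrightarrow> t v w \<Longrightarrow> \<not> t u w"
begin

lemma commute: "t u v \<longleftrightarrow> t v u"
  using sym by blast

definition gull :: "'a \<Rightarrow> 'a \<Rightarrow> 'a \<Rightarrow> bool" where
  "gull a c b \<longleftrightarrow> t a c \<and> \<not> t a b \<and> \<not> t c b \<and> a \<noteq> b \<and> c \<noteq> b"

lemma gull_distinct: "gull a c b \<Longrightarrow> a \<noteq> c \<and> a \<noteq> b \<and> c \<noteq> b"
  using irrefl by (auto simp: gull_def)

lemma gull_swap: "gull a c b \<Longrightarrow> gull c a b"
  by (auto simp: gull_def commute)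

section \<open>Packings of disjoint gulls\<close>

primrec packs :: "nat \<Rightarrow> 'a set \<Rightarrow> bool" where
  "packs 0 S \<longleftrightarrow> True"
| "packs (Suc n) S \<longleftrightarrow> (\<exists>a c b. {a, c, b} \<subseteq> S \<and> gull a c b \<and> packs n (S - {a, c, b}))"

lemma packs_mono: "packs n S \<Longrightarrow> S \<subseteq> S' \<Longrightarrow> packs n S'"
proof (induction n arbitrary: S S')
  case (Suc n)
  then obtain a c b where *: "{a, c, b} \<subseteq> S" "gull a c b" "packs n (S - {a, c, b})" by auto
  have "packs n (S' - {a, c, b})" by (rule Suc.IH[OF *(3)]) (use Suc.prems in auto)
  with * Suc.prems show ?case by (meson packs.simps(2) subset_trans)
qed simp

lemma packs_Un: "packs m A \<Longrightarrow> packs n B \<Longrightarrow> A \<inter> B = {} \<Longrightarrow> packs (m + n) (A \<union> B)"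
proof (induction m arbitrary: A)
  case 0
  then show ?case by (auto intro: packs_mono)
next
  case (Suc m)
  then obtain a c b where *: "{a, c, b} \<subseteq> A" "gull a c b" "packs m (A - {a, c, b})" by auto
  have "packs (m + n) ((A - {a, c, b}) \<union> B)" by (rule Suc.IH) (use * Suc.prems in auto)
  moreover have "(A - {a, c, b}) \<union> B = (A \<union> B) - {a, c, b}" using * Suc.prems by auto
  ultimately have "packs (m + n) ((A \<union> B) - {a, c, b})" by simp
  with * show ?case by (metis add_Suc packs.simps(2) le_supI1)
qed

lemma packs_1: "gull a c b \<Longrightarrow> {a, c, b} \<subseteq> S \<Longrightarrow> packs 1 S"
  by auto

lemma packs_2:
  assumes "gull a c b" "gull a' c' b'" "distinct [a, c, b, a', c', b']"
    "set [a, c, b, a', c', b'] \<subseteq> S"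
  shows "packs 2 S"
proof -
  have "packs (1 + 1) ({a, c, b} \<union> {a', c', b'})"
  proof (rule packs_Un)
    show "packs 1 {a, c, b}" "packs 1 {a', c', b'}" using assms packs_1 by blast+
    show "{a, c, b} \<inter> {a', c', b'} = {}" using assms(3) by auto
  qed
  then have "packs (1 + 1) S" by (rule packs_mono) (use assms(4) in auto)
  then show ?thesis by (simp only: one_add_one)
qed

lemma packs_3:
  assumes "gull a c b" "packs 2 S'" "a \<notin> S'" "c \<notin> S'" "b \<notin> S'" "insert a (insert c (insert b S')) \<subseteq> S"
  shows "packs 3 S"
proof -
  have "packs (1 + 2) ({a, c, b} \<union> S')"
    by (rule packs_Un) (use assms packs_1 in \<open>auto simp del: packs.simps\<close>)
  then have "packs (1 + 2) S" by (rule packs_mono) (use assms(6) in auto)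
  then show ?thesis by (simp only: one_plus_numeral semiring_norm)
qed

definition cell :: "('i \<Rightarrow> 'a) \<Rightarrow> ('i \<Rightarrow> 'a) \<Rightarrow> ('i \<Rightarrow> 'a) \<Rightarrow> 'i \<Rightarrow> 'a set" where
  "cell a c b i = {a i, c i, b i}"

text \<open>The indexed counterpart of \<open>packs\<close>: the recursive predicate is easy to
  enlarge and to concatenate, while exchange arguments must name the single gulls of a packing and
  their vertices.\<close>

definition gull_family ::
  "'i set \<Rightarrow> ('i \<Rightarrow> 'a) \<Rightarrow> ('i \<Rightarrow> 'a) \<Rightarrow> ('i \<Rightarrow> 'a) \<Rightarrow> bool" where
  "gull_family I a c b \<longleftrightarrow> finite I \<and> (\<forall>i\<in>I. gull (a i) (c i) (b i)) \<and>
     (\<forall>i\<in>I. \<forall>j\<in>I. i \<noteq> j \<longrightarrow> cell a c b i \<inter> cell a c b j = {})"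

lemma gull_family_subset: "gull_family I a c b \<Longrightarrow> J \<subseteq> I \<Longrightarrow> gull_family J a c b"
  unfolding gull_family_def by (meson finite_subset subsetD)

lemma packs_family:
  assumes "gull_family I a c b"
  shows "packs (card I) (\<Union>i\<in>I. cell a c b i)"
proof -
  have "finite I" using assms by (simp add: gull_family_def)
  then show ?thesis using assms
  proof (induction I rule: finite_induct)
    case (insert i I)
    have fam: "gull_family I a c b"
      by (rule gull_family_subset[OF insert.prems]) auto
    have "packs (1 + card I) (cell a c b i \<union> (\<Union>j\<in>I. cell a c b j))"
    proof (rule packs_Un)
      show "packs 1 (cell a c b i)"
        using insert.prems by (intro packs_1) (auto simp: gull_family_def cell_def)
      show "packs (card I) (\<Union>j\<in>I. cell a c b j)" using insert.IH[OF fam] .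
      have "cell a c b i \<inter> cell a c b j = {}" if "j \<in> I" for j
      proof -
        have "i \<noteq> j" using that insert.hyps(2) by auto
        with that show ?thesis using insert.prems by (simp add: gull_family_def)
      qed
      then show "cell a c b i \<inter> (\<Union>j\<in>I. cell a c b j) = {}" by blast
    qed
    then show ?case using insert.hyps by (simp del: packs.simps)
  qed simp
qed

lemma family_packs:
  assumes "packs n S"
  obtains a c b :: "nat \<Rightarrow> 'a" where "gull_family {..<n} a c b"
    "(\<Union>i<n. cell a c b i) \<subseteq> S"
proof -
  have "\<exists>a c b :: nat \<Rightarrow> 'a. gull_family {..<n} a c b \<and> (\<Union>i<n. cell a c b i) \<subseteq> S"
    using assms
  proof (induction n arbitrary: S)
    case 0
    then show ?case by (simp add: gull_family_def)
  next
    case (Suc n)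
    then obtain x y z where *: "{x, y, z} \<subseteq> S" "gull x y z" "packs n (S - {x, y, z})"
      by auto
    from Suc.IH[OF *(3)] obtain a c b :: "nat \<Rightarrow> 'a" where
      f: "gull_family {..<n} a c b" "(\<Union>i<n. cell a c b i) \<subseteq> S - {x, y, z}" by blast
    let ?cell = "cell (a(n := x)) (c(n := y)) (b(n := z))"
    have new: "?cell n = {x, y, z}" and old: "i < n \<Longrightarrow> ?cell i = cell a c b i" for i
      by (auto simp: cell_def)
    have dis: "cell a c b i \<inter> {x, y, z} = {}" if "i < n" for i
      using f(2) that by blast
    have "?cell i \<inter> ?cell j = {}" if "i < Suc n" "j < Suc n" "i \<noteq> j" for i j
      using that dis[of i] dis[of j] f(1) new old[of i] old[of j]
      unfolding gull_family_def less_Suc_eq by (metis inf_commute lessThan_iff)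
    then have "gull_family {..<Suc n} (a(n := x)) (c(n := y)) (b(n := z))"
      using f(1) *(2) unfolding gull_family_def by (auto simp: less_Suc_eq)
    moreover have "(\<Union>i<Suc n. ?cell i) \<subseteq> S"
      using f(2) *(1) new old by (force simp: less_Suc_eq)
    ultimately show ?case by blast
  qed
  then show thesis using that by blast
qed

lemma card_gull_family:
  assumes "gull_family I a c b"
  shows "card (\<Union>i\<in>I. cell a c b i) = 3 * card I"
proof -
  have "card (\<Union>i\<in>I. cell a c b i) = (\<Sum>i\<in>I. card (cell a c b i))"
    using assms by (intro card_UN_disjoint) (auto simp: gull_family_def cell_def)
  also have "\<dots> = (\<Sum>i\<in>I. 3)"
    using assms gull_distinct by (intro sum.cong) (auto simp: gull_family_def cell_def)
  finally show ?thesis by simp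
qed

text \<open>The form of every local improvement: the gulls of \<open>J\<close> are dissolved and
  repacked with vertices of \<open>L\<close> while the others stay. If \<open>n\<close> exceeds
  \<open>card J\<close>, the packing has grown.\<close>

lemma packs_exchange:
  assumes fam: "gull_family I a c b" and J: "J \<subseteq> I"
    and p: "packs n (L \<union> (\<Union>i\<in>J. cell a c b i))"
    and L: "L \<inter> (\<Union>i\<in>I. cell a c b i) = {}"
  shows "packs (card (I - J) + n) (L \<union> (\<Union>i\<in>I. cell a c b i))"
proof -
  have "gull_family (I - J) a c b" by (rule gull_family_subset[OF fam]) auto
  from packs_family[OF this] p
  have "packs (card (I - J) + n)
     ((\<Union>i\<in>I - J. cell a c b i) \<union> (L \<union> (\<Union>i\<in>J. cell a c b i)))"
  proof (rule packs_Un)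
    have "cell a c b i \<inter> cell a c b j = {}" if "i \<in> I - J" "j \<in> J" for i j
    proof -
      have "i \<noteq> j" "i \<in> I" "j \<in> I" using that J by auto
      then show ?thesis using fam by (simp add: gull_family_def)
    qed
    then show "(\<Union>i\<in>I - J. cell a c b i) \<inter> (L \<union> (\<Union>i\<in>J. cell a c b i)) = {}"
      using L by blast
  qed
  then show ?thesis by (rule packs_mono) (use J in blast)
qed

section \<open>Structure of sets without gulls\<close>

definition gull_free :: "'a set \<Rightarrow> bool" where
  "gull_free W \<longleftrightarrow> \<not> (\<exists>a\<in>W. \<exists>c\<in>W. \<exists>b\<in>W. gull a c b)"

definition stable :: "'a set \<Rightarrow> bool" where
  "stable S \<longleftrightarrow> (\<forall>u\<in>S. \<forall>v\<in>S. \<not> t u v)"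

definition full :: "'a \<Rightarrow> 'a set \<Rightarrow> bool" where
  "full v S \<longleftrightarrow> (\<forall>s\<in>S. t v s)"

definition biclique :: "'a set \<Rightarrow> 'a set \<Rightarrow> bool" where
  "biclique X Y \<longleftrightarrow> X \<noteq> {} \<and> Y \<noteq> {} \<and> (\<forall>x\<in>X. \<forall>y\<in>Y. t x y)"

lemma biclique_swap: "biclique X Y \<Longrightarrow> biclique Y X"
  unfolding biclique_def by (blast intro: sym)

lemma biclique_disjoint: "biclique X Y \<Longrightarrow> X \<inter> Y = {}"
  using irrefl by (auto simp: biclique_def)

lemma biclique_stable: "biclique X Y \<Longrightarrow> x \<in> X \<Longrightarrow> x' \<in> X \<Longrightarrow> \<not> t x x'"
  using sym triangle unfolding biclique_def by (metis ex_in_conv)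

lemma stable_gull_free: "stable W \<Longrightarrow> gull_free W"
  by (auto simp: stable_def gull_free_def gull_def)

lemma biclique_gull_free: 
  assumes "biclique X Y"
  shows "gull_free (X \<union> Y)"
proof -
  have "\<not> gull a c b" if "a \<in> X \<union> Y" "c \<in> X \<union> Y" "b \<in> X \<union> Y" for a c b
    using that assms biclique_stable[OF assms] biclique_stable[OF biclique_swap[OF assms]]
    unfolding gull_def biclique_def by (metis UnE sym)
  then show ?thesis by (auto simp: gull_free_def)
qed

text \<open>An edge of \<open>t\<close> and a vertex missing both of its ends form a gull, so on a
  gull-free set \<open>t\<close> is complete multipartite; without triangles there are at most two
  parts.\<close>

lemma gull_free_cases:
  assumes "gull_free W"
  obtains "stable W" | X Y where "biclique X Y" "X \<union> Y = W"
proof (cases "stable W")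
  case False
  then obtain u v where uv: "u \<in> W" "v \<in> W" "t u v" by (auto simp: stable_def)
  let ?X = "{w \<in> W. t w v}" and ?Y = "{w \<in> W. t w u}"
  have "biclique ?X ?Y" unfolding biclique_def
  proof (intro conjI ballI)
    show "?X \<noteq> {}" "?Y \<noteq> {}" using uv by (auto simp: commute)
    fix x y assume xy: "x \<in> ?X" "y \<in> ?Y"
    then have "x \<in> W" "y \<in> W" "t x v" "t v u" "t u y" using uv commute by auto
    moreover from this have "\<not> t v y" "x \<noteq> y" using uv triangle commute by metis+
    ultimately have "\<not> gull x v y" using assms uv(2) unfolding gull_free_def by blast
    then show "t x y"
      using \<open>t x v\<close> \<open>\<not> t v y\<close> \<open>x \<noteq> y\<close> unfolding gull_def by blast
  qed
  moreover have "?X \<union> ?Y = W"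
  proof -
    have "t w u \<or> t w v" if "w \<in> W" for w
    proof (rule ccontr)
      assume *: "\<not> (t w u \<or> t w v)"
      then have "gull u v w" using uv(3) commute unfolding gull_def by metis
      then show False using assms uv that unfolding gull_free_def by blast
    qed
    then show ?thesis by auto
  qed
  ultimately show thesis using that by blast
next
  case True
  then show thesis by (rule that(1))
qed


section \<open>One gull next to a biclique\<close>

text \<open>For an edge \<open>t a c\<close> beside a biclique: one end can join \<open>X\<close>
  and the other end \<open>Y\<close> so that the result is again a biclique.\<close>

definition aligned :: "'a \<Rightarrow> 'a \<Rightarrow> 'a set \<Rightarrow> 'a set \<Rightarrow> bool" where
  "aligned a c X Y \<longleftrightarrow> full a Y \<and> full c X \<or> full c Y \<and> full a X"

lemma aligned_swap: "aligned a c X Y \<longleftrightarrow> aligned a c Y X"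
  by (auto simp: aligned_def)

lemma aligned_commute: "aligned a c X Y \<longleftrightarrow> aligned c a X Y"
  by (auto simp: aligned_def)

text \<open>Complement of the five-wheel: a five-cycle \<open>x y a c y'\<close> together with an isolated vertex \<open>b\<close>.
  It has six vertices and meets every obvious necessary condition for two disjoint gulls, but has
  only one.\<close>

definition wheel :: "'a set \<Rightarrow> 'a set \<Rightarrow> 'a \<Rightarrow> 'a \<Rightarrow> 'a \<Rightarrow> bool" where
  "wheel X Y a c b \<longleftrightarrow> (\<exists>x y y'. X = {x} \<and> Y = {y, y'} \<and> y \<noteq> y' \<and> t a y \<and> t c y' \<and>
     \<not> t b x \<and> \<not> t b y \<and> \<not> t b y')"

text \<open>The remainder and one gull of a maximum packing. Both sides of a biclique are nonempty,
  so two distinct vertices on one side amount to at least three vertices in all.\<close>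

definition site :: "'a set \<Rightarrow> 'a set \<Rightarrow> 'a \<Rightarrow> 'a \<Rightarrow> 'a \<Rightarrow> bool" where
  "site X Y a c b \<longleftrightarrow> biclique X Y \<and> gull a c b \<and> {a, c, b} \<inter> (X \<union> Y) = {} \<and>
     ((\<exists>x\<in>X. \<exists>x'\<in>X. x \<noteq> x') \<or> (\<exists>y\<in>Y. \<exists>y'\<in>Y. y \<noteq> y')) \<and> \<not> packs 2 (X \<union> Y \<union> {a, c, b})"

lemma site_swap: "site X Y a c b \<Longrightarrow> site Y X a c b"
  unfolding site_def using biclique_swap by (metis Un_commute)

lemma site_commute: "site X Y a c b \<Longrightarrow> site X Y c a b"
  unfolding site_def using gull_swap by (metis insert_commute)

lemma gullI: "t a c \<Longrightarrow> \<not> t b a \<Longrightarrow> \<not> t b c \<Longrightarrow> a \<noteq> b \<Longrightarrow> c \<noteq> b \<Longrightarrow> gull a c b"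
  using commute by (simp add: gull_def)

lemma site_no2:
  assumes "site X Y a c b" "gull u v w" "gull u' v' w'" "distinct [u, v, w, u', v', w']"
    "set [u, v, w, u', v', w'] \<subseteq> X \<union> Y \<union> {a, c, b}"
  shows False
  using packs_2[OF assms(2-5)] assms(1) by (simp add: site_def)

lemma site_facts:
  assumes "site X Y a c b"
  shows "t a c" "t c a" "\<not> t a b" "\<not> t b a" "\<not> t c b" "\<not> t b c" "a \<noteq> b" "c \<noteq> b" "a \<noteq> c"
    "a \<notin> X" "a \<notin> Y" "c \<notin> X" "c \<notin> Y" "b \<notin> X" "b \<notin> Y"
    "\<And>x y. x \<in> X \<Longrightarrow> y \<in> Y \<Longrightarrow> t x y" "\<And>x y. x \<in> X \<Longrightarrow> y \<in> Y \<Longrightarrow> t y x"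
    "\<And>x. x \<in> X \<Longrightarrow> x \<notin> Y"
    "\<And>x x'. x \<in> X \<Longrightarrow> x' \<in> X \<Longrightarrow> \<not> t x x'" "\<And>y y'. y \<in> Y \<Longrightarrow> y' \<in> Y \<Longrightarrow> \<not> t y y'"
    "X \<noteq> {}" "Y \<noteq> {}"
    "(\<exists>x\<in>X. \<exists>x'\<in>X. x \<noteq> x') \<or> (\<exists>y\<in>Y. \<exists>y'\<in>Y. y \<noteq> y')"
proof -
  have B: "biclique X Y" and G: "gull a c b" and D: "{a, c, b} \<inter> (X \<union> Y) = {}"
    using assms by (simp_all add: site_def)
  show "t a c" "\<not> t a b" "\<not> t c b" "a \<noteq> b" "c \<noteq> b"
    using G by (simp_all add: gull_def)
  then show "t c a" "\<not> t b a" "\<not> t b c" using commute by blast+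
  show "a \<noteq> c" using gull_distinct[OF G] by blast
  show "a \<notin> X" "a \<notin> Y" "c \<notin> X" "c \<notin> Y" "b \<notin> X" "b \<notin> Y" using D by auto
  show *: "\<And>x y. x \<in> X \<Longrightarrow> y \<in> Y \<Longrightarrow> t x y" "X \<noteq> {}" "Y \<noteq> {}"
    using B by (simp_all add: biclique_def)
  show "\<And>x y. x \<in> X \<Longrightarrow> y \<in> Y \<Longrightarrow> t y x" using *(1) sym by blast
  show "\<And>x. x \<in> X \<Longrightarrow> x \<notin> Y" using *(1) irrefl by blast
  show "\<And>x x'. x \<in> X \<Longrightarrow> x' \<in> X \<Longrightarrow> \<not> t x x'" by (rule biclique_stable[OF B])
  show "\<And>y y'. y \<in> Y \<Longrightarrow> y' \<in> Y \<Longrightarrow> \<not> t y y'"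
    by (rule biclique_stable[OF biclique_swap[OF B]])
  show "(\<exists>x\<in>X. \<exists>x'\<in>X. x \<noteq> x') \<or> (\<exists>y\<in>Y. \<exists>y'\<in>Y. y \<noteq> y')"
    using assms by (simp add: site_def)
qed

lemma site_side:
  assumes "site X Y a c b" "x \<in> X" "y \<in> Y"
  shows "t v y \<Longrightarrow> \<not> t v x" "t v x \<Longrightarrow> \<not> t v y"
  using site_facts(16)[OF assms] triangle[of v x y] by auto

lemma site_full_side:
  assumes "site X Y a c b"
  shows "full v Y \<Longrightarrow> x \<in> X \<Longrightarrow> \<not> t v x" "full v X \<Longrightarrow> y \<in> Y \<Longrightarrow> \<not> t v y"
  using site_side[OF assms] site_facts(21,22)[OF assms] unfolding full_def by blast+

text \<open>A vertex \<open>r\<close> missing both \<open>a\<close> and \<open>c\<close> could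
  replace \<open>b\<close> in the gull, and the freed \<open>b\<close> would form a second gull with
  the edge \<open>x y\<close>.\<close>

lemma site_one:
  assumes s: "site X Y a c b" and r: "r \<in> X \<union> Y" "r \<noteq> x" "r \<noteq> y" "x \<in> X" "y \<in> Y"
    and b: "\<not> t b x" "\<not> t b y"
  shows "t a r \<or> t c r"
proof (rule ccontr)
  assume "\<not> (t a r \<or> t c r)"
  then have "\<not> t r a" "\<not> t r c" using commute by blast+
  moreover have "a \<noteq> r" "c \<noteq> r" "x \<noteq> b" "y \<noteq> b"
    using site_facts(10-15)[OF s] r by blast+
  ultimately have "gull a c r" "gull x y b"
    using site_facts(1)[OF s] site_facts(16)[OF s r(4,5)] b by (simp_all add: gullI)
  then show False using site_facts(7-15,18)[OF s] r
    by (intro site_no2[OF s, of a c r x y b]) auto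
qed

text \<open>Since \<open>b\<close> misses the biclique, it completes every edge there to a gull, and
  \<open>site_one\<close> applies throughout. Neither \<open>a\<close> nor \<open>c\<close> is
  complete to \<open>Y\<close>, so \<open>Y\<close> splits into neighbours of \<open>a\<close> and
  neighbours of \<open>c\<close>, both present. Then \<open>a\<close> and \<open>c\<close> miss
  \<open>X\<close>, and a third vertex in \<open>Y\<close> or a second one in \<open>X\<close> would
  give two gulls: only the five-cycle remains.\<close>

lemma site_isolated:
  assumes s: "site X Y a c b" and b: "\<And>v. v \<in> X \<union> Y \<Longrightarrow> \<not> t b v"
    and y: "\<exists>y\<in>Y. \<exists>y'\<in>Y. y \<noteq> y'" and n: "\<not> aligned a c X Y"
  shows "wheel X Y a c b"
proof -
  note f = site_facts[OF s]
  obtain x where x: "x \<in> X" using f by auto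
  have one: "t a r \<or> t c r" if "r \<in> Y" for r
  proof -
    obtain y where "y \<in> Y" "y \<noteq> r" using y by metis
    then show ?thesis using site_one[OF s, of r x y] x that b[of x] b[of y] f(18)[OF x] by blast
  qed
  have oneX: "t a r \<or> t c r" if "r \<in> X" "r \<noteq> x'" "x' \<in> X" for r x'
  proof -
    obtain y where "y \<in> Y" using f(22) by blast
    then show ?thesis using site_one[OF s, of r x' y] that b[of x'] b[of y] f(18)[of r] by blast
  qed
  \<comment> \<open>Lack of alignment provides an \<open>x\<close> that \<open>c\<close> misses;
    then \<open>a y' b\<close> and \<open>x y c\<close> are disjoint gulls.\<close>
  have X: False if ac: "site X Y a c b" "\<not> aligned a c X Y" "full a Y"
      "\<And>r x'. r \<in> X \<Longrightarrow> r \<noteq> x' \<Longrightarrow> x' \<in> X \<Longrightarrow> t a r \<or> t c r" for a c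
  proof -
    note f = site_facts[OF ac(1)]
    obtain x where x: "x \<in> X" "\<not> t c x" using ac by (auto simp: aligned_def full_def)
    obtain y y' where yy: "y \<in> Y" "y' \<in> Y" "y \<noteq> y'" using y by auto
    have ay: "t a y" "t a y'" using ac yy by (auto simp: full_def)
    have "a \<noteq> b" "y' \<noteq> b" "x \<noteq> c" "y \<noteq> c" "\<not> t c y" "\<not> t b y'" "\<not> t b a" "t x y"
      using f(4,7) f(12-16) b[of y'] yy x(1) triangle[OF f(2) ay(1)] by auto
    then have "gull a y' b" "gull x y c" using ay x(2) by (simp_all add: gullI)
    then show False using f(7-15,18) yy x
      by (intro site_no2[OF ac(1), of a y' b x y c]) auto
  qed
  have nY: "\<not> full a Y" "\<not> full c Y"
    using X[OF s n] X[OF site_commute[OF s]] n oneX by (metis aligned_commute)+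
  then obtain y y' where yy: "y \<in> Y" "y' \<in> Y" "t a y" "t c y'" "\<not> t c y" "\<not> t a y'"
    using one by (metis full_def)
  have ax: "\<not> t a v" "\<not> t c v" if "v \<in> X" for v
    using yy(1-4) site_side(1)[OF s that] by blast+
  have Y: "Y = {y, y'}"
  proof (rule ccontr)
    assume "Y \<noteq> {y, y'}"
    then obtain z where z: "z \<in> Y" "z \<noteq> y" "z \<noteq> y'" using yy by auto
    have "x \<noteq> b" "y \<noteq> b" "y' \<noteq> b" "t x y" "t x y'" using f(14-16) x yy by auto
    then have "gull x y b" "gull x y' b" using b[of x] b[of y] b[of y'] x yy by (simp_all add: gullI)
    consider "t a z" | "t c z" using one z by auto
    then show False
    proof cases
      case 1
      moreover have "a \<noteq> y'" "\<not> t y' z" "\<not> t y' a" using f(11,20) z yy commute by auto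
      ultimately have "gull a z y'" using z by (simp add: gullI)
      then show False using \<open>gull x y b\<close> f(7-15,18) z yy x
        by (intro site_no2[OF s, of a z y' x y b]) auto
    next
      case 2
      moreover have "c \<noteq> y" "\<not> t y z" "\<not> t y c" using f(13,20) z yy commute by auto
      ultimately have "gull c z y" using z by (simp add: gullI)
      then show False using \<open>gull x y' b\<close> f(7-15,18) z yy x
        by (intro site_no2[OF s, of c z y x y' b]) auto
    qed
  qed
  have "X = {x}"
    using oneX ax x by auto
  then show ?thesis using Y yy b x unfolding wheel_def by blast
qed

text \<open>Let \<open>b\<close> see \<open>x1\<close> and miss \<open>x2\<close>. By
  \<open>site_one\<close> with the edge \<open>x2 y\<close>, one end of the gull's edge, say
  \<open>a\<close>, sees \<open>x1\<close>. If \<open>c\<close> missed some \<open>y\<close>, then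
  \<open>a c y\<close> and \<open>b x1 x2\<close> would be gulls; if \<open>a\<close> missed
  \<open>x2\<close>, then \<open>a x1 x2\<close> and \<open>c y b\<close> would be. The rest of
  \<open>X\<close> is handled by \<open>site_one\<close>.\<close>

lemma site_mixed:
  assumes s: "site X Y a c b" and n: "\<not> full b X" and x1: "x1 \<in> X" "t b x1"
  shows "aligned a c X Y"
proof -
  note f = site_facts[OF s]
  obtain x2 where x2: "x2 \<in> X" "\<not> t b x2" using n by (auto simp: full_def)
  have bY: "\<not> t b y" if "y \<in> Y" for y using x1 that site_side[OF s] by blast
  have *: "aligned a c X Y" if s: "site X Y a c b" and a: "t a x1" for a c
  proof -
    note f = site_facts[OF s]
    have aY: "\<not> t a y" if "y \<in> Y" for y using x1 that a site_side[OF s] by blast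
    have cY: "t c y" if "y \<in> Y" for y
    proof (rule ccontr)
      assume "\<not> t c y"
      moreover have "a \<noteq> y" "c \<noteq> y" "b \<noteq> x2" "\<not> t x2 x1" "\<not> t x2 b" "\<not> t y a"
        using f(11,13,14,19) aY[OF that] that x1 x2 commute by auto
      moreover have "x1 \<noteq> x2" using x1 x2 by auto
      ultimately have "gull a c y" "gull b x1 x2" using f(1) x1 commute[of c y] by (simp_all add: gullI)
      then show False using f(7-15,18) that x1 x2
        by (intro site_no2[OF s, of a c y b x1 x2]) auto
    qed
    obtain y where y: "y \<in> Y" using f(22) by blast
    have cX: "\<not> t c x" if "x \<in> X" for x using cY[OF y] y that site_side[OF s] by blast
    have "t a x" if x: "x \<in> X" for x
    proof (cases "x = x2")
      case False
      then show ?thesis using site_one[OF s, of x x2 y] cX[OF x] x x2 y f(18) bY[OF y] by blast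
    next
      case True
      show ?thesis
      proof (rule ccontr)
        assume "\<not> t a x"
        moreover have "a \<noteq> x2" "\<not> t x2 x1" "x1 \<noteq> x2" "c \<noteq> b" "y \<noteq> b" "t c y"
          using f(8,10,15,19) x1 x2 y cY by auto
        ultimately have "gull a x1 x2" "gull c y b"
          using True a f(6) bY[OF y] commute[of a x2] by (simp_all add: gullI)
        then show False using f(7-15,18) x1 x2 y
          by (intro site_no2[OF s, of a x1 x2 c y b]) auto
      qed
    qed
    then show ?thesis using cY by (auto simp: aligned_def full_def)
  qed
  obtain y where y: "y \<in> Y" using f(22) by blast
  have "t a x1 \<or> t c x1" using site_one[OF s, of x1 x2 y] x1 x2 y f(18) bY[OF y] by blast
  then show ?thesis using *[OF s] *[OF site_commute[OF s]] aligned_commute by blast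
qed

text \<open>Apart from the wheels, every outcome lets a vertex of the gull join a side of the
  biclique: \<open>b\<close> itself or, in the aligned case, either end of the edge.\<close>

lemma site_cases:
  assumes s: "site X Y a c b"
  obtains "aligned a c X Y" | "full b Y" | "full b X" | "wheel X Y a c b" | "wheel Y X a c b"
proof -
  have "aligned a c X Y \<or> full b Y \<or> full b X \<or> wheel X Y a c b \<or> wheel Y X a c b"
  proof (cases "\<exists>v\<in>X \<union> Y. t b v")
    case True
    then show ?thesis using site_mixed[OF s] site_mixed[OF site_swap[OF s]] aligned_swap by blast
  next
    case False
    then show ?thesis
      using site_isolated[OF s] site_isolated[OF site_swap[OF s]] site_facts(23)[OF s]
        aligned_swap by blast
  qed
  then show thesis using that by blast
qed

text \<open>If \<open>c\<close> missed some \<open>x0\<close>, an edge from \<open>x0\<close> into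
  \<open>Y\<close> would form a gull with \<open>c\<close>. The vertices \<open>a\<close> and
  \<open>b\<close> form another with one more vertex of the biclique, which is \<open>a y b\<close>
  or \<open>b x a\<close> depending on the side that has a vertex to spare.\<close>

lemma site_edge:
  assumes s: "site X Y a c b" and b: "full b X" and a: "full a Y"
  shows "full c X"
proof (rule ccontr)
  assume "\<not> full c X"
  then obtain x0 where x0: "x0 \<in> X" "\<not> t c x0" by (auto simp: full_def)
  note f = site_facts[OF s]
  have bY: "\<not> t b y" if "y \<in> Y" for y using b that site_full_side[OF s] by blast
  have aX: "\<not> t a x" if "x \<in> X" for x using a that site_full_side[OF s] by blast
  have cY: "\<not> t c y" if "y \<in> Y" for y
    using a that f(1) triangle[of a c y] unfolding full_def by blast
  consider y y' where "y \<in> Y" "y' \<in> Y" "y \<noteq> y'" | x y where "x \<in> X" "x \<noteq> x0" "y \<in> Y"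
    using f(22,23) by (metis ex_in_conv)
  then show False
  proof cases
    case 1
    then have "t a y" "y \<noteq> b" "x0 \<noteq> c" "y' \<noteq> c" "t x0 y'"
      using f(12,13,15,16) a x0(1) by (auto simp: full_def)
    then have "gull a y b" "gull x0 y' c"
      using 1 f(4,7) x0(2) bY[of y] cY[of y'] by (simp_all add: gullI)
    then show False using f(7-15,18) x0 1
      by (intro site_no2[OF s, of a y b x0 y' c]) auto
  next
    case 2
    then have "t b x" "x \<noteq> a" "x0 \<noteq> c" "y \<noteq> c" "t x0 y"
      using f(10,12,13,16) b x0(1) by (auto simp: full_def)
    then have "gull b x a" "gull x0 y c"
      using 2 f(3,7) x0(2) aX[of x] cY[of y] by (simp_all add: gullI)
    then show False using f(7-15,18) x0 2
      by (intro site_no2[OF s, of b x a x0 y c]) auto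
  qed
qed

text \<open>Otherwise \<open>a\<close> and \<open>c\<close> together see all of \<open>X\<close>,
  but by \<open>site_edge\<close> neither does alone, and \<open>a x1 x2\<close>,
  \<open>b y c\<close> are two gulls. The vertex obtained completes the edge \<open>a c\<close> to a
  gull, so it can trade places with \<open>b\<close>.\<close>

lemma site_replace:
  assumes s: "site X Y a c b" and n: "\<not> aligned a c X Y" and b: "full b Y"
  obtains x where "x \<in> X" "\<not> t a x" "\<not> t c x"
proof -
  note f = site_facts[OF s]
  have "\<exists>x\<in>X. \<not> t a x \<and> \<not> t c x"
  proof (rule ccontr)
    assume "\<not> ?thesis"
    then have all: "t a x \<or> t c x" if "x \<in> X" for x using that by blast
    have "\<not> full a X" "\<not> full c X"
      using site_edge[OF site_swap[OF s] b] site_edge[OF site_swap[OF site_commute[OF s]] b] n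
      by (auto simp: aligned_def)
    then obtain x1 x2 where x: "x1 \<in> X" "x2 \<in> X" "\<not> t c x1" "\<not> t a x2" "t a x1" "t c x2"
      using all by (metis full_def)
    obtain y where y: "y \<in> Y" using f(22) by blast
    have "\<not> t c y" using x(2,6) y site_side[OF s] by blast
    moreover have "t b y" "y \<noteq> c" "a \<noteq> x2" "x1 \<noteq> x2" "\<not> t x2 x1" "\<not> t x2 a"
      using f(10,13,19) x y b commute[of x2 a] by (auto simp: full_def)
    ultimately have "gull a x1 x2" "gull b y c" using x f(5,8) by (simp_all add: gullI)
    then show False using f(7-15,18) x y
      by (intro site_no2[OF s, of a x1 x2 b y c]) auto
  qed
  then show thesis using that by blast
qed


section \<open>Excluding the five-wheel\<close>

lemma packs_three:
  assumes "gull a c b" "gull a' c' b'" "gull u v w" "distinct [a, c, b, a', c', b', u, v, w]"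
    "set [a, c, b, a', c', b', u, v, w] \<subseteq> S"
  shows "packs 3 S"
proof (rule packs_3[OF assms(1)])
  show "packs 2 {a', c', b', u, v, w}"
    by (rule packs_2[OF assms(2,3)]) (use assms(4) in auto)
qed (use assms(4,5) in auto)

text \<open>A wheel with isolated vertex \<open>z\<close> beside a second gull. There are nine
  vertices, so three disjoint gulls would use all of them.\<close>

definition pentagon ::
  "'a \<Rightarrow> 'a \<Rightarrow> 'a \<Rightarrow> 'a \<Rightarrow> 'a \<Rightarrow> 'a \<Rightarrow> 'a \<Rightarrow> 'a \<Rightarrow> 'a \<Rightarrow> bool" where
  "pentagon v0 v1 v2 v3 v4 z a c b \<longleftrightarrow>
     t v0 v1 \<and> t v1 v2 \<and> t v2 v3 \<and> t v3 v4 \<and> t v4 v0 \<and>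
     \<not> t z v0 \<and> \<not> t z v1 \<and> \<not> t z v2 \<and> \<not> t z v3 \<and> \<not> t z v4 \<and> gull a c b \<and>
     distinct [v0, v1, v2, v3, v4, z, a, c, b] \<and> \<not> packs 3 {v0, v1, v2, v3, v4, z, a, c, b}"

lemma pentagon_rotate: "pentagon v0 v1 v2 v3 v4 z a c b \<Longrightarrow> pentagon v1 v2 v3 v4 v0 z a c b"
proof -
  assume p: "pentagon v0 v1 v2 v3 v4 z a c b"
  have "{v1, v2, v3, v4, v0, z, a, c, b} = {v0, v1, v2, v3, v4, z, a, c, b}" by blast
  then show ?thesis using p unfolding pentagon_def by auto
qed

lemma pentagon_commute: "pentagon v0 v1 v2 v3 v4 z a c b \<Longrightarrow> pentagon v0 v1 v2 v3 v4 z c a b"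
proof -
  assume p: "pentagon v0 v1 v2 v3 v4 z a c b"
  have "{v0, v1, v2, v3, v4, z, c, a, b} = {v0, v1, v2, v3, v4, z, a, c, b}" by blast
  then show ?thesis using p gull_swap unfolding pentagon_def by auto
qed

text \<open>The edge opposite to \<open>v0\<close> forms the gull \<open>v2 v3 z\<close>, which is
  set aside. What remains of the cycle is the biclique \<open>{v0}\<close>, \<open>{v1, v4}\<close>
  beside \<open>a c b\<close>, and the disjuncts are the outcomes of
  \<open>site_cases\<close>.\<close>

lemma pentagon_site:
  assumes "pentagon v0 v1 v2 v3 v4 z a c b"
  shows "t a v4 \<and> t a v1 \<and> t c v0 \<or> t c v4 \<and> t c v1 \<and> t a v0 \<or> t b v4 \<and> t b v1 \<or> t b v0 \<or>
    \<not> t b v0 \<and> \<not> t b v1 \<and> \<not> t b v4 \<and> (t a v1 \<and> t c v4 \<or> t a v4 \<and> t c v1)"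
proof -
  have t: "t v0 v1" "t v2 v3" "t v0 v4" and z: "\<not> t z v2" "\<not> t z v3" and g: "gull a c b"
    and d: "distinct [v0, v1, v2, v3, v4, z, a, c, b]"
    and n: "\<not> packs 3 {v0, v1, v2, v3, v4, z, a, c, b}"
    using assms commute[of v4 v0] by (auto simp: pentagon_def)
  have "gull v2 v3 z" using t(2) z d by (simp add: gullI)
  then have n2: "\<not> packs 2 ({v0} \<union> {v1, v4} \<union> {a, c, b})"
    using packs_3[of v2 v3 z "{v0} \<union> {v1, v4} \<union> {a, c, b}" "{v0, v1, v2, v3, v4, z, a, c, b}"] n d
    by (auto simp del: packs.simps)
  have s: "site {v0} {v1, v4} a c b"
    unfolding site_def
  proof (intro conjI)
    show "biclique {v0} {v1, v4}" using t by (simp add: biclique_def)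
    show "(\<exists>x\<in>{v0}. \<exists>x'\<in>{v0}. x \<noteq> x') \<or> (\<exists>y\<in>{v1, v4}. \<exists>y'\<in>{v1, v4}. y \<noteq> y')"
      using d by auto
  qed (use g d n2 in auto)
  show ?thesis
  proof (cases rule: site_cases[OF s])
    case 4
    then obtain y y' where "{v1, v4} = {y, y'}" "t a y" "t c y'" "\<not> t b v0" "\<not> t b y" "\<not> t b y'"
      by (auto simp: wheel_def)
    then show ?thesis by (auto simp: doubleton_eq_iff)
  next
    case 5
    then have False using d by (auto simp: wheel_def)
    then show ?thesis ..
  qed (auto simp: aligned_def full_def)
qed

text \<open>Here \<open>a\<close>, \<open>c\<close>, \<open>b\<close> see the cycle as
  \<open>v2\<close>, \<open>v3\<close>, \<open>v0\<close> do. This pattern satisfies all five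
  rotated conditions of \<open>pentagon_site\<close>, so it needs gulls of its own:
  \<open>v2 v3 z\<close>, \<open>v0 v1 c\<close> and \<open>b v4 a\<close>.\<close>

lemma pentagon_no_blowup:
  assumes "pentagon v0 v1 v2 v3 v4 z a c b"
  shows "\<not> (t b v1 \<and> t b v4 \<and> t a v1 \<and> t a v3 \<and> t c v2 \<and> t c v4)"
proof
  assume *: "t b v1 \<and> t b v4 \<and> t a v1 \<and> t a v3 \<and> t c v2 \<and> t c v4"
  have t: "t v0 v1" "t v2 v3" "t v1 v2" "t v3 v4" "t v4 v0" and z: "\<not> t z v2" "\<not> t z v3"
    and g: "gull a c b" and d: "distinct [v0, v1, v2, v3, v4, z, a, c, b]"
    and n: "\<not> packs 3 {v0, v1, v2, v3, v4, z, a, c, b}"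
    using assms by (auto simp: pentagon_def)
  have "gull v2 v3 z" using t(2) z d by (simp add: gullI)
  have "\<not> t c v0" "\<not> t c v1" "\<not> t a v4"
    using triangle t * commute[of v1 v2] by blast+
  moreover have "\<not> t a b" "b \<noteq> a" using g by (auto simp: gull_def)
  ultimately have "gull v0 v1 c" "gull b v4 a" using d t * by (simp_all add: gullI)
  with \<open>gull v2 v3 z\<close> show False
    using n packs_three[of v2 v3 z v0 v1 c b v4 a "{v0, v1, v2, v3, v4, z, a, c, b}"] d by auto
qed

lemma no_pentagon: "\<not> pentagon v0 v1 v2 v3 v4 z a c b"
proof
  assume p0: "pentagon v0 v1 v2 v3 v4 z a c b"
  note p1 = pentagon_rotate[OF p0] note p2 = pentagon_rotate[OF p1]
  note p3 = pentagon_rotate[OF p2] note p4 = pentagon_rotate[OF p3]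
  note q0 = pentagon_commute[OF p0] and q1 = pentagon_commute[OF p1]
    and q2 = pentagon_commute[OF p2] and q3 = pentagon_commute[OF p3] and q4 = pentagon_commute[OF p4]
  have "t v0 v1" "t v1 v2" "t v2 v3" "t v3 v4" "t v4 v0"
    using p0 by (auto simp: pentagon_def)
  then have e: "\<not> (t w v0 \<and> t w v1)" "\<not> (t w v1 \<and> t w v2)" "\<not> (t w v2 \<and> t w v3)"
    "\<not> (t w v3 \<and> t w v4)" "\<not> (t w v4 \<and> t w v0)" for w
    using triangle by blast+
  have ac: "\<not> (t a w \<and> t c w)" for w
    using p0 triangle[of a c w] by (auto simp: pentagon_def gull_def)
  note sites = pentagon_site[OF p0] pentagon_site[OF p1] pentagon_site[OF p2]
    pentagon_site[OF p3] pentagon_site[OF p4]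
  note bl = pentagon_no_blowup[OF p0] pentagon_no_blowup[OF p1] pentagon_no_blowup[OF p2]
    pentagon_no_blowup[OF p3] pentagon_no_blowup[OF p4] pentagon_no_blowup[OF q0]
    pentagon_no_blowup[OF q1] pentagon_no_blowup[OF q2] pentagon_no_blowup[OF q3]
    pentagon_no_blowup[OF q4]
  \<comment> \<open>The fifteen adjacencies between \<open>a\<close>, \<open>b\<close>,
    \<open>c\<close> and the cycle are propositional variables. Triangle-freeness, the five rotated
    site conditions and the blow-up exclusion under rotations and the exchange of \<open>a\<close>
    and \<open>c\<close> contradict each other.\<close>
  show False
    using sites bl e[of a] e[of b] e[of c] ac[of v0] ac[of v1] ac[of v2] ac[of v3] ac[of v4]
    by sat
qed

end

section \<open>Maximum packings that leave a biclique\<close>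

text \<open>The edges \<open>a i\<close>, \<open>c i\<close> of the gulls and the side \<open>Y\<close> of the remainder are kept fixed; the
  third vertices \<open>b i\<close> and the side \<open>X\<close> vary, because they can be exchanged with each other.\<close>

locale biclique_remainder = triangle_free t for t :: "'a \<Rightarrow> 'a \<Rightarrow> bool" +
  fixes V :: "'a set" and I :: "'i set" and a c :: "'i \<Rightarrow> 'a" and Y :: "'a set"
  assumes finite_V: "finite V"
    and large: "3 * card I + 3 \<le> card V"
    and maximal: "\<not> packs (Suc (card I)) V"
    and not_five_wheel: "card I \<noteq> 1 \<or> card V \<noteq> 6"
begin

definition state :: "'a set \<Rightarrow> ('i \<Rightarrow> 'a) \<Rightarrow> bool" where
  "state X b \<longleftrightarrow> gull_family I a c b \<and> biclique X Y \<and>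
     (X \<union> Y) \<inter> (\<Union>i\<in>I. cell a c b i) = {} \<and> V = X \<union> Y \<union> (\<Union>i\<in>I. cell a c b i)"

text \<open>Maximality made local: a gain on the gulls of \<open>J\<close> and the remainder would
  be a gain for the whole packing. It is applied to one gull or to two.\<close>

lemma state_no_packs:
  assumes s: "state X b" and J: "J \<subseteq> I"
  shows "\<not> packs (Suc (card J)) (X \<union> Y \<union> (\<Union>i\<in>J. cell a c b i))"
proof
  assume "packs (Suc (card J)) (X \<union> Y \<union> (\<Union>i\<in>J. cell a c b i))"
  then have "packs (card (I - J) + Suc (card J)) V"
    using packs_exchange[of I a c b J "Suc (card J)" "X \<union> Y"] s J by (simp add: state_def)
  moreover have "finite I" using s by (simp add: state_def gull_family_def)
  then have "card (I - J) + Suc (card J) = Suc (card I)"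
    using J by (simp add: card_Diff_subset finite_subset card_mono)
  ultimately show False using maximal by (simp del: packs.simps)
qed

lemma state_card:
  assumes "state X b"
  shows "card V = card (X \<union> Y) + 3 * card I"
proof -
  have "finite (X \<union> Y)" "finite (\<Union>i\<in>I. cell a c b i)"
    using assms finite_V by (auto simp: state_def)
  then show ?thesis using assms card_gull_family[of I a c b]
    by (simp add: state_def card_Un_disjoint)
qed

lemma state_site:
  assumes s: "state X b" and i: "i \<in> I"
  shows "site X Y (a i) (c i) (b i)"
  unfolding site_def
proof (intro conjI)
  show "biclique X Y" "gull (a i) (c i) (b i)"
    using s i by (simp_all add: state_def gull_family_def)
  show "{a i, c i, b i} \<inter> (X \<union> Y) = {}"
    using s i unfolding state_def cell_def by blast
  show "\<not> packs 2 (X \<union> Y \<union> {a i, c i, b i})"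
    using state_no_packs[OF s, of "{i}"] i by (simp add: cell_def numeral_2_eq_2 del: packs.simps)
  \<comment> \<open>The bound \<open>large\<close> leaves at least three vertices outside the gulls,
    more than one on each side.\<close>
  show "(\<exists>x\<in>X. \<exists>x'\<in>X. x \<noteq> x') \<or> (\<exists>y\<in>Y. \<exists>y'\<in>Y. y \<noteq> y')"
  proof (rule ccontr)
    assume *: "\<not> ?thesis"
    obtain x y where "x \<in> X" "y \<in> Y" using s by (auto simp: state_def biclique_def)
    with * have "X \<union> Y \<subseteq> {x, y}" by blast
    then have "card (X \<union> Y) \<le> card {x, y}" by (rule card_mono[rotated]) simp
    also have "\<dots> \<le> 2" by (simp add: card_insert_if)
    finally show False using state_card[OF s] large by simp
  qed
qed

text \<open>A wheel means a remainder of three vertices, so with a single gull \<open>V\<close>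
  would have six. Hence there is a second gull, and it forms a pentagon with the wheel.\<close>

lemma state_no_wheel:
  assumes s: "state X b" and i: "i \<in> I" and w: "wheel A B (a i) (c i) (b i)"
    and AB: "A = X \<and> B = Y \<or> A = Y \<and> B = X"
  shows False
proof -
  have site: "site A B (a i) (c i) (b i)"
    using state_site[OF s i] site_swap AB by blast
  note f = site_facts[OF site]
  obtain x y y' where w: "A = {x}" "B = {y, y'}" "y \<noteq> y'" "t (a i) y" "t (c i) y'"
    "\<not> t (b i) x" "\<not> t (b i) y" "\<not> t (b i) y'"
    using w unfolding wheel_def by blast
  have XY: "X \<union> Y = {x, y, y'}" using AB w by auto
  have d: "distinct [x, y, a i, c i, y', b i]" using f(7-15,18) w by auto
  have "card (X \<union> Y) = 3" using XY d by auto
  then have "card V = 3 + 3 * card I" using state_card[OF s] by simp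
  then have "card I \<noteq> 1" using not_five_wheel by auto
  then obtain j where j: "j \<in> I" "j \<noteq> i"
    using i by (metis One_nat_def card.empty card.insert empty_iff finite.intros(1) insertI1
        is_singletonI' is_singleton_altdef)
  have g: "gull (a j) (c j) (b j)" using s j by (simp add: state_def gull_family_def)
  have "cell a c b i \<inter> cell a c b j = {}" "cell a c b j \<inter> (X \<union> Y) = {}"
    using s i j unfolding state_def gull_family_def by blast+
  then have "distinct [x, y, a i, c i, y', b i, a j, c j, b j]"
    using d gull_distinct[OF g] XY unfolding cell_def by auto
  moreover have "{x, y, a i, c i, y', b i, a j, c j, b j} = X \<union> Y \<union> (\<Union>k\<in>{i, j}. cell a c b k)"
    using XY by (auto simp: cell_def)
  then have "\<not> packs 3 {x, y, a i, c i, y', b i, a j, c j, b j}"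
    using state_no_packs[OF s, of "{i, j}"] i j by (simp add: numeral_3_eq_3 del: packs.simps)
  moreover have "t x y" "t y (a i)" "t y' x" using f(16,17) w commute[of y] by auto
  ultimately have "pentagon x y (a i) (c i) y' (b i) (a j) (c j) (b j)"
    using w f(1,4,6) g by (simp add: pentagon_def del: packs.simps)
  then show False using no_pentagon by blast
qed

definition aligned_at :: "'a set \<Rightarrow> 'i \<Rightarrow> bool" where
  "aligned_at X i \<longleftrightarrow> aligned (a i) (c i) X Y"

lemma state_cases:
  assumes s: "state X b" and i: "i \<in> I"
  obtains "aligned_at X i" | "full (b i) Y" | "full (b i) X"
  using site_cases[OF state_site[OF s i]] state_no_wheel[OF s i] unfolding aligned_at_def by metis

text \<open>Defined from the fixed side \<open>Y\<close> alone, so that exchanges do not affect it.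
  In an aligned gull the inner vertex can join \<open>X\<close> and the outer one
  \<open>Y\<close>.\<close>

definition inner :: "'i \<Rightarrow> 'a" where
  "inner i = (if full (a i) Y then a i else c i)"

definition outer :: "'i \<Rightarrow> 'a" where
  "outer i = (if full (a i) Y then c i else a i)"

lemma aligned_at_iff:
  assumes "state X b" "i \<in> I"
  shows "aligned_at X i \<longleftrightarrow> full (inner i) Y \<and> full (outer i) X"
proof -
  have "\<not> (full v X \<and> full v Y)" for v
    using site_full_side(1)[OF state_site[OF assms]] site_facts(21)[OF state_site[OF assms]]
    by (auto simp: full_def)
  then show ?thesis by (auto simp: aligned_at_def aligned_def inner_def outer_def)
qed

lemma outer_in_cell: "outer i \<in> cell a c b i"
  by (simp add: outer_def cell_def)

text \<open>A consequence of \<open>site_edge\<close>. An exchange can destroy alignment only at the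
  outer vertex; the inner one remains complete to \<open>Y\<close>, and then
  \<open>full (b i) Y\<close> is the only outcome left in \<open>state_cases\<close>.\<close>

lemma full_inner_aligned:
  assumes s: "state X b" and i: "i \<in> I" and b: "full (b i) X" and p: "full (inner i) Y"
  shows "aligned_at X i"
  using site_edge[OF state_site[OF s i] b] site_edge[OF site_commute[OF state_site[OF s i]] b] p
  by (auto simp: aligned_at_def aligned_def inner_def split: if_splits)

lemma not_full_both:
  assumes "state X b" "i \<in> I" "full v X" shows "\<not> full v Y"
  using assms site_full_side(1)[OF state_site[OF assms(1,2)]] site_facts(21)[OF state_site[OF assms(1,2)]]
  by (auto simp: full_def)

text \<open>By \<open>site_replace\<close>, both gulls can give up their third vertices for some
  \<open>x\<close> and \<open>y\<close>. If \<open>b g\<close> missed \<open>b h\<close>, the two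
  freed vertices and one more vertex of the remainder would form a third gull.\<close>

lemma opposite_adjacent:
  assumes s: "state X b" and g: "g \<in> I" "\<not> aligned_at X g" "full (b g) Y"
    and h: "h \<in> I" "\<not> aligned_at X h" "full (b h) X"
  shows "t (b g) (b h)"
proof (rule ccontr)
  assume nt: "\<not> t (b g) (b h)"
  have gh: "g \<noteq> h" using not_full_both[OF s h(1,3)] g by auto
  note sg = state_site[OF s g(1)] and sh = state_site[OF s h(1)]
  note fg = site_facts[OF sg] and fh = site_facts[OF sh]
  obtain x where x: "x \<in> X" "\<not> t (a g) x" "\<not> t (c g) x"
    using site_replace[OF sg] g by (auto simp: aligned_at_def)
  obtain y where y: "y \<in> Y" "\<not> t (a h) y" "\<not> t (c h) y"
    using site_replace[OF site_swap[OF sh]] h aligned_swap by (auto simp: aligned_at_def)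
  have "cell a c b g \<inter> cell a c b h = {}"
    using s g(1) h(1) gh by (simp add: state_def gull_family_def)
  then have d: "distinct [a g, c g, b g, a h, c h, b h]"
    using fg(7-9) fh(7-9) by (auto simp: cell_def)
  have g1: "gull (a g) (c g) x" "gull (a h) (c h) y"
    using x y fg(1,10-15) fh(1,10-15) by (auto simp: gull_def)
  have "packs 3 (X \<union> Y \<union> (\<Union>k\<in>{g, h}. cell a c b k))"
  proof (cases "\<exists>y1\<in>Y. y1 \<noteq> y")
    case True
    then obtain y1 where y1: "y1 \<in> Y" "y1 \<noteq> y" by blast
    have "\<not> t (b h) y1" using site_full_side(2)[OF sh h(3) y1(1)] .
    then have "gull (b g) y1 (b h)"
      using g(3) y1 d nt fh(15) commute[of "b g"] by (auto simp: full_def intro!: gullI)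
    then show ?thesis
      by (rule packs_three[OF g1]) (use d x y y1 fg(7-15,18) fh(7-15,18) in \<open>auto simp: cell_def\<close>)
  next
    case False
    then obtain x1 where x1: "x1 \<in> X" "x1 \<noteq> x" using fg(23) x by metis
    have "\<not> t (b g) x1" using site_full_side(1)[OF sg g(3) x1(1)] .
    then have "gull (b h) x1 (b g)"
      using h(3) x1 d nt fg(14) by (auto simp: full_def intro!: gullI)
    then show ?thesis
      by (rule packs_three[OF g1]) (use d x y x1 fg(7-15,18) fh(7-15,18) in \<open>auto simp: cell_def\<close>)
  qed
  then show False using state_no_packs[OF s, of "{g, h}"] g(1) h(1) gh
    by (simp add: numeral_3_eq_3 del: packs.simps)
qed


text \<open>Since \<open>x\<close> misses \<open>a g\<close> and \<open>c g\<close>, it completes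
  their gull; since \<open>b g\<close> is complete to \<open>Y\<close>, it can take the place of
  \<open>x\<close> in the biclique.\<close>

lemma state_exchange:
  assumes s: "state X b" and g: "g \<in> I" "full (b g) Y"
    and x: "x \<in> X" "\<not> t (a g) x" "\<not> t (c g) x"
  shows "state (insert (b g) (X - {x})) (b(g := x))"
proof -
  note f = site_facts[OF state_site[OF s g(1)]]
  let ?b = "b(g := x)"
  have fam: "gull_family I a c b" and bi: "biclique X Y"
    and dis: "(X \<union> Y) \<inter> (\<Union>i\<in>I. cell a c b i) = {}" and V: "V = X \<union> Y \<union> (\<Union>i\<in>I. cell a c b i)"
    using s by (simp_all add: state_def)
  have other: "cell a c ?b i = cell a c b i" if "i \<noteq> g" for i
    using that by (simp add: cell_def)
  have self: "cell a c ?b g = insert x (cell a c b g - {b g})" "b g \<in> cell a c b g"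
    using f(7,8) by (auto simp: cell_def)
  have xn: "x \<notin> cell a c b i" if "i \<in> I" for i
    using dis x(1) that by blast
  have disj: "cell a c b i \<inter> cell a c b j = {}" if "i \<in> I" "j \<in> I" "i \<noteq> j" for i j
    using fam that by (simp add: gull_family_def)
  have un: "(\<Union>i\<in>I. cell a c ?b i) = insert x ((\<Union>i\<in>I. cell a c b i) - {b g})"
  proof -
    have "(\<Union>i\<in>I. cell a c ?b i) = cell a c ?b g \<union> (\<Union>i\<in>I - {g}. cell a c ?b i)"
      using g(1) by blast
    also have "\<dots> = insert x (cell a c b g - {b g}) \<union> (\<Union>i\<in>I - {g}. cell a c b i)"
      using self other by simp
    also have "\<dots> = insert x ((cell a c b g \<union> (\<Union>i\<in>I - {g}. cell a c b i)) - {b g})"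
      using disj[OF g(1)] self(2) by blast
    also have "cell a c b g \<union> (\<Union>i\<in>I - {g}. cell a c b i) = (\<Union>i\<in>I. cell a c b i)"
      using g(1) by blast
    finally show ?thesis .
  qed
  have xg: "x \<noteq> b g" "x \<notin> Y" using f(14,18) x by auto
  show ?thesis unfolding state_def
  proof (intro conjI)
    show "gull_family I a c ?b"
      unfolding gull_family_def
    proof (intro conjI ballI impI)
      show "finite I" using fam by (simp add: gull_family_def)
      show "gull (a i) (c i) (?b i)" if "i \<in> I" for i
        using fam that f(1,10,12) x by (auto simp: gull_family_def gull_def)
      show "cell a c ?b i \<inter> cell a c ?b j = {}" if "i \<in> I" "j \<in> I" "i \<noteq> j" for i j
        using disj[OF that] that xn other self by (cases "i = g"; cases "j = g") auto
    qed
    show "biclique (insert (b g) (X - {x})) Y"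
      using bi g(2) by (auto simp: biclique_def full_def)
    have "b g \<in> (\<Union>i\<in>I. cell a c b i)" using self(2) g(1) by blast
    then show "V = insert (b g) (X - {x}) \<union> Y \<union> (\<Union>i\<in>I. cell a c ?b i)"
      unfolding V un using x(1) xg by blast
    show "(insert (b g) (X - {x}) \<union> Y) \<inter> (\<Union>i\<in>I. cell a c ?b i) = {}"
      unfolding un using dis f(15) xg by blast
  qed
qed

text \<open>An unaligned gull whose vertex \<open>b\<close> is complete to \<open>Y\<close> must contribute that vertex to a
  gull-free transversal. This forces the same on every aligned gull whose outer vertex misses it, and
  so on along a chain. Exchanging the first \<open>b\<close> of a chain into \<open>X\<close> shortens the chain, hence the
  forced vertices never conflict.\<close>

definition chain :: "'a set \<Rightarrow> ('i \<Rightarrow> 'a) \<Rightarrow> nat \<Rightarrow> (nat \<Rightarrow> 'i) \<Rightarrow> bool" where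
  "chain X b n f \<longleftrightarrow> f 0 \<in> I \<and> \<not> aligned_at X (f 0) \<and> full (b (f 0)) Y \<and>
     (\<forall>m<n. f (Suc m) \<in> I \<and> aligned_at X (f (Suc m)) \<and> \<not> t (outer (f (Suc m))) (b (f m)))"

text \<open>The induction runs over all states at once, because shortening a chain changes
  \<open>X\<close> and \<open>b\<close>. The second conjunct makes the end of a chain, bound for the
  side of \<open>X\<close>, compatible with those \<open>b h\<close> that can only go to the side of
  \<open>Y\<close>.\<close>

lemma chain_end:
  assumes "state X b" "chain X b n f"
  shows "full (b (f n)) Y \<and> (\<forall>h\<in>I. \<not> aligned_at X h \<longrightarrow> full (b h) X \<longrightarrow> t (b (f n)) (b h))"
  using assms
proof (induction n arbitrary: X b f rule: less_induct)
  case (less n)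
  note s = less.prems(1)
  define g where "g = f 0"
  have g: "g \<in> I" "\<not> aligned_at X g" "full (b g) Y"
    using less.prems(2) by (simp_all add: chain_def g_def)
  have step: "f (Suc m) \<in> I" "aligned_at X (f (Suc m))" "\<not> t (outer (f (Suc m))) (b (f m))"
    if "m < n" for m
    using less.prems(2) that by (simp_all add: chain_def)
  consider "n = 0" | m where "0 < m" "m < n" "\<not> t (outer (f (Suc m))) (b g)"
    | k where "n = Suc k" "\<And>m. 0 < m \<Longrightarrow> m < n \<Longrightarrow> t (outer (f (Suc m))) (b g)"
    by (metis not0_implies_Suc)
  then show ?case
  proof cases
    case 1
    then show ?thesis using g opposite_adjacent[OF s g] by (simp add: g_def)
  next
    \<comment> \<open>A shortcut: the outer vertex of a later gull misses \<open>b g\<close> itself,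
      so the stretch in between can be skipped.\<close>
    case 2
    define f' where "f' = (\<lambda>l. if l = 0 then g else f (m + l))"
    have "chain X b (n - m) f'"
      unfolding chain_def
    proof (intro conjI allI impI)
      show "f' 0 \<in> I" "\<not> aligned_at X (f' 0)" "full (b (f' 0)) Y"
        using g by (simp_all add: f'_def)
      fix l assume "l < n - m"
      then show "f' (Suc l) \<in> I" "aligned_at X (f' (Suc l))"
          "\<not> t (outer (f' (Suc l))) (b (f' l))"
        using step[of "m + l"] 2 by (auto simp: f'_def)
    qed
    moreover have "n - m < n" "f' (n - m) = f n" using 2 by (auto simp: f'_def)
    ultimately show ?thesis using less.IH[of "n - m" X b f'] s by metis
  next
    case 3
    obtain x where x: "x \<in> X" "\<not> t (a g) x" "\<not> t (c g) x"
      using site_replace[OF state_site[OF s g(1)]] g by (auto simp: aligned_at_def)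
    \<comment> \<open>Without shortcuts, the outer vertices after \<open>f 1\<close> all see
      \<open>b g\<close>. Trading \<open>b g\<close> for \<open>x\<close> keeps those gulls aligned
      and spoils \<open>f 1\<close>, whose own third vertex must then be complete to
      \<open>Y\<close>; so the tail is a chain of the new state.\<close>
    define X' where "X' = insert (b g) (X - {x})"
    define b' where "b' = b(g := x)"
    have s': "state X' b'" unfolding X'_def b'_def by (rule state_exchange[OF s g(1,3) x])
    have ne: "f (Suc m) \<noteq> g" if "m < n" for m using step(2)[OF that] g(2) by metis
    have f1: "f (Suc 0) \<in> I" "aligned_at X (f (Suc 0))" "\<not> t (outer (f (Suc 0))) (b g)"
      using step[of 0] 3(1) by (simp_all add: g_def)
    have inner1: "full (inner (f (Suc 0))) Y" using f1(2) aligned_at_iff[OF s f1(1)] by simp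
    have na: "\<not> aligned_at X' (f (Suc 0))"
      using f1(3) aligned_at_iff[OF s' f1(1)] by (simp add: X'_def full_def)
    have full1: "full (b' (f (Suc 0))) Y"
      using state_cases[OF s' f1(1)] na full_inner_aligned[OF s' f1(1) _ inner1] by metis
    have "chain X' b' k (\<lambda>m. f (Suc m))"
      unfolding chain_def
    proof (intro conjI allI impI)
      show "f (Suc 0) \<in> I" "\<not> aligned_at X' (f (Suc 0))" "full (b' (f (Suc 0))) Y"
        by fact+
      fix m assume m: "m < k"
      then have m': "Suc m < n" "m < n" using 3(1) by auto
      show "f (Suc (Suc m)) \<in> I" using step(1)[OF m'(1)] .
      show "\<not> t (outer (f (Suc (Suc m)))) (b' (f (Suc m)))"
        using step(3)[OF m'(1)] ne[OF m'(2)] by (simp add: b'_def)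
      show "aligned_at X' (f (Suc (Suc m)))"
        using step(1,2)[OF m'(1)] 3(2)[OF _ m'(1)] aligned_at_iff[OF s] aligned_at_iff[OF s']
        by (auto simp: X'_def full_def)
    qed
    then have IH: "full (b' (f n)) Y"
      "\<And>h. h \<in> I \<Longrightarrow> \<not> aligned_at X' h \<Longrightarrow> full (b' h) X' \<Longrightarrow> t (b' (f n)) (b' h)"
      using less.IH[of k X' b' "\<lambda>m. f (Suc m)"] s' 3(1) by auto
    have bn: "b' (f n) = b (f n)" using ne[of k] 3(1) by (simp add: b'_def)
    have "t (b (f n)) (b h)" if h: "h \<in> I" "\<not> aligned_at X h" "full (b h) X" for h
    proof -
      have "h \<noteq> g" using not_full_both[OF s h(1,3)] g by auto
      then have bh: "b' h = b h" by (simp add: b'_def)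
      have full: "full (b' h) X'"
        using h(3) opposite_adjacent[OF s g h] commute unfolding bh by (auto simp: X'_def full_def)
      have "\<not> aligned_at X' h"
        using aligned_at_iff[OF s' h(1)] full_inner_aligned[OF s h(1,3)] h(2) by blast
      then show ?thesis using IH(2)[OF h(1) _ full] bh bn by simp
    qed
    then show ?thesis using IH(1) bn by simp
  qed
qed

lemma gull_free_transversal:
  assumes s: "state X b"
  shows "\<exists>W\<subseteq>V. gull_free W \<and> card W + 2 * card I = card V"
proof -
  \<comment> \<open>The ends of all chains. An aligned gull outside \<open>R\<close> has an outer
    vertex that sees \<open>b i\<close> for every \<open>i\<close> in \<open>R\<close>, since
    otherwise it would prolong a chain; an unaligned one outside \<open>R\<close> is not even a
    chain of length zero, so its third vertex is complete to \<open>X\<close>.\<close>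
  define R where "R = {i. \<exists>n f. chain X b n f \<and> f n = i}"
  have RI: "R \<subseteq> I"
  proof
    fix i assume "i \<in> R"
    then obtain n f where "chain X b n f" "f n = i" by (auto simp: R_def)
    then show "i \<in> I" by (cases n) (auto simp: chain_def)
  qed
  have RY: "full (b i) Y" if "i \<in> R" for i
    using that chain_end[OF s] by (auto simp: R_def)
  have Rb: "t (b i) (b h)" if "i \<in> R" "h \<in> I" "\<not> aligned_at X h" "full (b h) X" for i h
    using that chain_end[OF s] by (auto simp: R_def)
  have Rq: "t (outer h) (b i)" if i: "i \<in> R" and h: "h \<in> I - R" "aligned_at X h" for i h
  proof (rule ccontr)
    assume nt: "\<not> t (outer h) (b i)"
    obtain n f where f: "chain X b n f" "f n = i" using i by (auto simp: R_def)
    have "chain X b (Suc n) (f(Suc n := h))"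
      using f h nt by (auto simp: chain_def less_Suc_eq)
    then have "h \<in> R" unfolding R_def by (metis (mono_tags, lifting) fun_upd_same mem_Collect_eq)
    then show False using h by simp
  qed
  have fullX: "full (b h) X" if "h \<in> I - R" "\<not> aligned_at X h" for h
  proof -
    have "\<not> full (b h) Y"
    proof
      assume "full (b h) Y"
      then have "chain X b 0 (\<lambda>_. h)" using that by (simp add: chain_def)
      then have "h \<in> R" by (auto simp: R_def)
      then show False using that by simp
    qed
    then show ?thesis using state_cases[OF s, of h] that by blast
  qed
  \<comment> \<open>Gulls in \<open>R\<close> contribute to the side of \<open>X\<close>, all others
    to the side of \<open>Y\<close>.\<close>
  define w where "w i = (if i \<in> R \<or> \<not> aligned_at X i then b i else outer i)" for i
  have wX: "full (w i) X" if "i \<in> I - R" for i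
    using that fullX aligned_at_iff[OF s] by (auto simp: w_def)
  have bi: "biclique X Y" using s by (simp add: state_def)
  have "biclique (X \<union> w ` R) (Y \<union> w ` (I - R))"
    unfolding biclique_def
  proof (intro conjI ballI)
    show "X \<union> w ` R \<noteq> {}" "Y \<union> w ` (I - R) \<noteq> {}" using bi by (auto simp: biclique_def)
    fix u v assume "u \<in> X \<union> w ` R" "v \<in> Y \<union> w ` (I - R)"
    then consider "u \<in> X" "v \<in> Y" | h where "u \<in> X" "h \<in> I - R" "v = w h"
      | i where "i \<in> R" "u = b i" "v \<in> Y" | i h where "i \<in> R" "u = b i" "h \<in> I - R" "v = w h"
      by (auto simp: w_def)
    then show "t u v"
    proof cases
      case 1
      then show ?thesis using bi by (simp add: biclique_def)
    next
      case 2
      then show ?thesis using wX[of h] commute[of u] by (simp add: full_def)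
    next
      case 3
      then show ?thesis using RY[of i] by (simp add: full_def)
    next
      case 4
      then show ?thesis
        using Rb[of i h] fullX[of h] Rq[of i h] commute[of u v] by (auto simp: w_def)
    qed
  qed
  then have free: "gull_free (X \<union> Y \<union> w ` I)"
  proof -
    have "X \<union> w ` R \<union> (Y \<union> w ` (I - R)) = X \<union> Y \<union> w ` I" using RI by blast
    with biclique_gull_free[OF \<open>biclique (X \<union> w ` R) (Y \<union> w ` (I - R))\<close>] show ?thesis by simp
  qed
  have fam: "gull_family I a c b" "(X \<union> Y) \<inter> (\<Union>i\<in>I. cell a c b i) = {}"
    "V = X \<union> Y \<union> (\<Union>i\<in>I. cell a c b i)" using s by (simp_all add: state_def)
  have wc: "w i \<in> cell a c b i" for i
    using outer_in_cell by (auto simp: w_def cell_def)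
  have inj: "inj_on w I"
  proof (rule inj_onI)
    fix i j assume "i \<in> I" "j \<in> I" "w i = w j"
    then show "i = j" using wc[of i] wc[of j] fam(1) unfolding gull_family_def
      by (metis IntI empty_iff)
  qed
  have sub: "w ` I \<subseteq> (\<Union>i\<in>I. cell a c b i)" using wc by blast
  then have "(X \<union> Y) \<inter> w ` I = {}" using fam(2) by blast
  moreover have "finite (X \<union> Y)" "finite (w ` I)"
    using finite_V fam by (auto simp: gull_family_def)
  ultimately have "card (X \<union> Y \<union> w ` I) = card (X \<union> Y) + card I"
    using card_Un_disjoint[of "X \<union> Y" "w ` I"] card_image[OF inj] by simp
  moreover have "X \<union> Y \<union> w ` I \<subseteq> V" using fam(3) sub by blast
  ultimately show ?thesis using free state_card[OF s] by (intro exI[of _ "X \<union> Y \<union> w ` I"]) simp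
qed

end

section \<open>Gulls versus gull-free sets\<close>

context triangle_free begin

text \<open>No \<open>card I\<close> disjoint gulls leave an edge, so the remainder \<open>L\<close>
  is stable. From each gull a vertex missing \<open>L\<close> is selected; that the selected
  vertices miss each other is shown by repacking two gulls with up to three vertices of
  \<open>L\<close>.\<close>

lemma stable_remainder:
  assumes fin: "finite V" and large: "3 * card I + 3 \<le> card V"
    and fam: "gull_family I a c b" and V: "V = L \<union> (\<Union>i\<in>I. cell a c b i)"
    and L: "L \<inter> (\<Union>i\<in>I. cell a c b i) = {}"
    and no: "\<And>u v. u \<in> V \<Longrightarrow> v \<in> V \<Longrightarrow> t u v \<Longrightarrow> \<not> packs (card I) (V - {u, v})"
  shows "\<exists>W\<subseteq>V. gull_free W \<and> card W + 2 * card I = card V"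
proof -
  have finI: "finite I" using fam by (simp add: gull_family_def)
  have disj: "cell a c b i \<inter> cell a c b j = {}" if "i \<in> I" "j \<in> I" "i \<noteq> j" for i j
    using fam that by (simp add: gull_family_def)
  \<comment> \<open>The hypothesis \<open>no\<close> made local. Repacking \<open>J\<close> into
    equally many gulls is already a contradiction when an edge is left over, whereas maximality
    would require an additional gull.\<close>
  have noJ: False if J: "J \<subseteq> I" and S: "S \<subseteq> L \<union> (\<Union>i\<in>J. cell a c b i)" and p: "packs (card J) S"
    and uv: "u \<in> L \<union> (\<Union>i\<in>J. cell a c b i) - S" "v \<in> L \<union> (\<Union>i\<in>J. cell a c b i) - S" "t u v" for J S u v
  proof -
    have "packs (card (I - J)) (\<Union>i\<in>I - J. cell a c b i)"
      by (rule packs_family[OF gull_family_subset[OF fam]]) auto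
    moreover have UT: "(\<Union>i\<in>I - J. cell a c b i) \<inter> (L \<union> (\<Union>i\<in>J. cell a c b i)) = {}"
    proof -
      have "cell a c b i \<inter> cell a c b j = {}" if "i \<in> I - J" "j \<in> J" for i j
        using disj[of i j] that J by auto
      then show ?thesis using L by blast
    qed
    have "(\<Union>i\<in>I - J. cell a c b i) \<inter> S = {}" using UT S by (metis Int_mono bot.extremum_uniqueI order_refl)
    ultimately have "packs (card (I - J) + card J) ((\<Union>i\<in>I - J. cell a c b i) \<union> S)"
      using p by (intro packs_Un)
    moreover have TV: "(\<Union>i\<in>I - J. cell a c b i) \<subseteq> V" "L \<union> (\<Union>i\<in>J. cell a c b i) \<subseteq> V"
      unfolding V using J by auto
    then have sub: "(\<Union>i\<in>I - J. cell a c b i) \<union> S \<subseteq> V - {u, v}"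
      using S uv(1,2) UT by (simp add: subset_iff disjoint_iff) metis
    moreover have "card (I - J) + card J = card I"
      using J finI by (simp add: card_Diff_subset finite_subset card_mono)
    ultimately have "packs (card I) (V - {u, v})" using packs_mono[OF _ sub] by simp
    then show False using no[OF _ _ uv(3)] uv(1,2) TV(2) by blast
  qed
  have Lst: "\<not> t u v" if "u \<in> L" "v \<in> L" for u v
    using noJ[of "{}" "{}" u v] that by auto
  have finL: "finite L" using fin V by auto
  have "card V = card L + card (\<Union>i\<in>I. cell a c b i)"
    unfolding V by (rule card_Un_disjoint[OF finL _ L]) (use fin V in auto)
  then have cV: "card V = card L + 3 * card I" using card_gull_family[OF fam] by simp
  then have L3: "3 \<le> card L" using large by simp
  have third: "\<exists>l''\<in>L. l'' \<noteq> l \<and> l'' \<noteq> l'" for l l'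
  proof (rule ccontr)
    assume "\<not> ?thesis"
    then have "L \<subseteq> {l, l'}" by blast
    then have "card L \<le> card {l, l'}" by (rule card_mono[rotated]) simp
    also have "\<dots> \<le> 2" by (simp add: card_insert_if)
    finally show False using L3 by simp
  qed
  have notL: "v \<notin> L" if "v \<in> cell a c b g" "g \<in> I" for v g using that L by blast
  have ne: "v \<noteq> l" "l \<noteq> v" if "v \<in> cell a c b g" "g \<in> I" "l \<in> L" for v g l
    using notL[OF that(1,2)] that(3) by auto
  have gn: "a g \<notin> L" "c g \<notin> L" "b g \<notin> L" if "g \<in> I" for g
    using notL[of _ g] that by (auto simp: cell_def)
  have one: False if g: "g \<in> I" and S: "gull x y z" "{x, y, z} \<subseteq> L \<union> cell a c b g"
    and uv: "u \<in> L \<union> cell a c b g - {x, y, z}" "v \<in> L \<union> cell a c b g - {x, y, z}" "t u v"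
    for g x y z u v
    by (rule noJ[of "{g}" "{x, y, z}" u v]) (use that in auto)
  have zero_or_full: "full (b g) L \<or> (\<forall>l\<in>L. \<not> t (b g) l)" if g: "g \<in> I" for g
  proof (rule ccontr)
    assume "\<not> ?thesis"
    then obtain l l' where l: "l \<in> L" "l' \<in> L" "t (b g) l" "\<not> t (b g) l'" by (auto simp: full_def)
    have gg: "gull (a g) (c g) (b g)" using fam g by (simp add: gull_family_def)
    have "l \<noteq> l'" using l by auto
    moreover have "b g \<noteq> l'" by (rule ne(1)[OF _ g l(2)]) (simp add: cell_def)
    ultimately have "gull (b g) l l'" using l Lst by (auto intro!: gullI simp: commute[of l' "b g"])
    then show False
    proof (rule one[OF g])
      show "t (a g) (c g)" using gg by (simp add: gull_def)
    qed (use l gull_distinct[OF gg] gn[OF g] in \<open>auto simp: cell_def\<close>)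
  qed
  \<comment> \<open>Here \<open>p\<close> is the end of the gull's edge that is complete to
    \<open>L\<close>; by triangle-freeness \<open>q\<close> misses \<open>L\<close> and is the
    vertex to select.\<close>
  define A where "A g p q \<longleftrightarrow> (p = a g \<and> q = c g \<or> p = c g \<and> q = a g) \<and> full p L" for g p q
  have Afacts: "t p q" "\<And>l. l \<in> L \<Longrightarrow> \<not> t q l" "\<not> t p (b g)" "\<not> t q (b g)" "p \<noteq> b g" "q \<noteq> b g" "p \<noteq> q"
    "p \<in> cell a c b g" "q \<in> cell a c b g" "full p L"
    if g: "g \<in> I" and A: "A g p q" for g p q
  proof -
    have gg: "gull (a g) (c g) (b g)" using fam g by (simp add: gull_family_def)
    show "t p q" "\<not> t p (b g)" "\<not> t q (b g)" "p \<noteq> b g" "q \<noteq> b g" "p \<noteq> q"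
      using A gg gull_swap[OF gg] gull_distinct[OF gg] by (auto simp: A_def gull_def)
    then show "\<And>l. l \<in> L \<Longrightarrow> \<not> t q l" using A triangle[of p q] by (auto simp: A_def full_def)
    show "p \<in> cell a c b g" "q \<in> cell a c b g" "full p L" using A by (auto simp: A_def cell_def)
  qed
  \<comment> \<open>If some \<open>l\<close> misses both ends, then \<open>a g\<close>,
    \<open>c g\<close>, \<open>l\<close> form a gull and \<open>b g\<close> must not leave an edge
    to another vertex of \<open>L\<close>. If no \<open>l\<close> does, one end is complete to
    \<open>L\<close>; otherwise an end with mixed adjacency forms a gull with two vertices of
    \<open>L\<close>, leaving an edge from the other end to a third.\<close>
  have types: "(\<exists>p q. A g p q) \<or> (\<forall>l\<in>L. \<not> t (b g) l) \<and> (\<exists>l\<in>L. \<not> t (a g) l \<and> \<not> t (c g) l)"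
    if g: "g \<in> I" for g
  proof -
    have gg: "gull (a g) (c g) (b g)" using fam g by (simp add: gull_family_def)
    note d = gull_distinct[OF gg]
    have mixed: "\<not> t y l''" if xy: "x = a g \<and> y = c g \<or> x = c g \<and> y = a g"
      and l: "l \<in> L" "l' \<in> L" "l'' \<in> L" "l'' \<noteq> l" "l'' \<noteq> l'" "t x l" "\<not> t x l'" for x y l l' l''
    proof
      assume "t y l''"
      have "l \<noteq> l'" using l by auto
      moreover have "x \<noteq> l'" by (rule ne(1)[OF _ g l(2)]) (use xy in \<open>auto simp: cell_def\<close>)
      ultimately have "gull x l l'" using l Lst by (auto intro!: gullI simp: commute[of l' x])
      then show False
        by (rule one[OF g _ _ _ _ \<open>t y l''\<close>]) (use xy l d gn[OF g] in \<open>auto simp: cell_def\<close>)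
    qed
    show ?thesis
    proof (cases "\<exists>l\<in>L. \<not> t (a g) l \<and> \<not> t (c g) l")
      case True
      then obtain l where l: "l \<in> L" "\<not> t (a g) l" "\<not> t (c g) l" by blast
      obtain l' where l': "l' \<in> L" "l' \<noteq> l" using third by blast
      have "gull (a g) (c g) l" using l gg gn[OF g] by (auto simp: gull_def)
      then have "\<not> t (b g) l'"
        using one[OF g, of "a g" "c g" l "b g" l'] l l' d gn[OF g] by (auto simp: cell_def)
      then show ?thesis using zero_or_full[OF g] True l' by (auto simp: full_def)
    next
      case False
      have "full (a g) L \<or> full (c g) L"
      proof (rule ccontr)
        assume "\<not> ?thesis"
        then obtain l1 l2 where l: "l1 \<in> L" "l2 \<in> L" "\<not> t (a g) l1" "\<not> t (c g) l2"
          by (auto simp: full_def)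
        then have l': "t (c g) l1" "t (a g) l2" using False by auto
        obtain l3 where "l3 \<in> L" "l3 \<noteq> l1" "l3 \<noteq> l2" using third by blast
        then show False
          using False l l' mixed[of "a g" "c g" l2 l1 l3] mixed[of "c g" "a g" l1 l2 l3] by auto
      qed
      then show ?thesis by (auto simp: A_def)
    qed
  qed
  define w where "w g = (if full (a g) L then c g else if full (c g) L then a g else b g)" for g
  have wc: "w g \<in> cell a c b g" for g by (simp add: w_def cell_def)
  have w_cases: "(\<exists>p. A g p (w g)) \<or>
      w g = b g \<and> (\<forall>l\<in>L. \<not> t (b g) l) \<and> (\<exists>l\<in>L. \<not> t (a g) l \<and> \<not> t (c g) l)"
    if g: "g \<in> I" for g
    using types[OF g] by (auto simp: A_def w_def)
  have two: False if gh: "g \<in> I" "h \<in> I" "g \<noteq> h"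
    and S: "gull x y z" "gull x' y' z'" "distinct [x, y, z, x', y', z', u, v]"
      "set [x, y, z, x', y', z', u, v] \<subseteq> L \<union> cell a c b g \<union> cell a c b h" "t u v"
    for g h x y z x' y' z' u v
  proof -
    define T where "T = L \<union> (\<Union>i\<in>{g, h}. cell a c b i)"
    have "set [x, y, z, x', y', z', u, v] \<subseteq> T"
      using S(4) unfolding T_def by (simp only: UN_insert UN_empty Un_empty_right Un_assoc)
    then have T: "{x, y, z, x', y', z'} \<subseteq> T" "u \<in> T - {x, y, z, x', y', z'}"
      "v \<in> T - {x, y, z, x', y', z'}"
      using S(3) by auto
    have "packs (card {g, h}) {x, y, z, x', y', z'}"
      using packs_2[OF S(1,2), of "{x, y, z, x', y', z'}"] S(3) gh(3)
      by (simp add: numeral_2_eq_2 del: packs.simps)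
    then show False
      by (rule noJ[of "{g, h}" _ u v, folded T_def, OF _ T(1) _ T(2,3) S(5), rotated]) (use gh in simp)
  qed
  have cross: "u \<noteq> v" if "u \<in> cell a c b g" "v \<in> cell a c b h" "g \<in> I" "h \<in> I" "g \<noteq> h" for u v g h
    using disj[of g h] that by blast
  \<comment> \<open>If \<open>b g\<close> saw \<open>v\<close>, the gulls \<open>a g\<close>,
    \<open>c g\<close>, \<open>l\<close> and \<open>b g\<close>, \<open>v\<close>, \<open>l'\<close>
    would leave an edge at \<open>p\<close>, either inside the other cell or to
    \<open>l''\<close>.\<close>
  have NN: "\<not> t (b g) v"
    if gh: "g \<in> I" "h \<in> I" "g \<noteq> h" and N: "\<forall>l\<in>L. \<not> t (b g) l" "\<exists>l\<in>L. \<not> t (a g) l \<and> \<not> t (c g) l"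
      and v: "v \<in> cell a c b h" "\<forall>l\<in>L. \<not> t v l"
      and e: "\<exists>p\<in>cell a c b h. \<exists>q\<in>cell a c b h. p \<noteq> v \<and> q \<noteq> v \<and> t p q \<or>
        p \<noteq> v \<and> full p L" for g h v
  proof
    assume bv: "t (b g) v"
    obtain l where l: "l \<in> L" "\<not> t (a g) l" "\<not> t (c g) l" using N by blast
    obtain l' where l': "l' \<in> L" "l' \<noteq> l" using third by blast
    obtain l'' where l'': "l'' \<in> L" "l'' \<noteq> l" "l'' \<noteq> l'" using third by blast
    have gg: "gull (a g) (c g) (b g)" using fam gh by (simp add: gull_family_def)
    note d = gull_distinct[OF gg]
    have cg: "a g \<in> cell a c b g" "c g \<in> cell a c b g" "b g \<in> cell a c b g" by (auto simp: cell_def)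
    note neg = ne(1)[OF cg(1) gh(1)] ne(1)[OF cg(2) gh(1)] ne(1)[OF cg(3) gh(1)]
    have g1: "gull (a g) (c g) l" using l gg neg(1,2)[OF l(1)] by (simp add: gull_def)
    have g2: "gull (b g) v l'"
      using bv N(1) v(2) l' neg(3)[OF l'(1)] ne(1)[OF v(1) gh(2) l'(1)] by (auto simp: gull_def)
    have "\<exists>p q. t p q \<and> p \<in> cell a c b h \<and> p \<noteq> v \<and> (q \<in> cell a c b h \<and> q \<noteq> v \<or> q = l'')"
      using e l'' by (auto simp: full_def)
    then obtain p q where pq: "t p q" "p \<in> cell a c b h" "p \<noteq> v" "q \<in> cell a c b h \<and> q \<noteq> v \<or> q = l''"
      by blast
    have "p \<noteq> q" using pq irrefl by metis
    moreover have q: "q \<notin> cell a c b g" "q \<noteq> v" "q \<noteq> l" "q \<noteq> l'" "q \<in> L \<union> cell a c b h"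
      using pq(4) cross[OF _ _ gh, of _ q] ne[OF _ gh(2)] ne[OF _ gh(1), of _ l''] l l' l'' v(1) by blast+
    moreover have nc: "p \<notin> cell a c b g" "v \<notin> cell a c b g"
      using cross[OF _ _ gh] pq(2) v(1) by blast+
    ultimately have "distinct [a g, c g, l, b g, v, l', p, q]"
      using pq(3) l'(2) d neg[OF l(1)] neg[OF l'(1)] ne(1)[OF pq(2) gh(2) l(1)]
        ne(1)[OF pq(2) gh(2) l'(1)] ne(1)[OF v(1) gh(2) l(1)] ne(1)[OF v(1) gh(2) l'(1)]
      unfolding cell_def by auto
    moreover have "set [a g, c g, l, b g, v, l', p, q] \<subseteq> L \<union> cell a c b g \<union> cell a c b h"
      using cg l(1) l'(1) v(1) pq(2) q(5) by auto
    ultimately show False by (rule two[OF gh g1 g2 _ _ pq(1)])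
  qed
  \<comment> \<open>Suppose \<open>q\<close> sees \<open>q'\<close>. If one of the third vertices is
    complete to \<open>L\<close>, then \<open>p l q'\<close> and \<open>p' l' q\<close> leave its
    edge to \<open>l''\<close>; if both miss \<open>L\<close>, they complete \<open>p l\<close> and
    \<open>p' l'\<close> to gulls that leave \<open>q q'\<close>.\<close>
  have AA: "\<not> t q q'" if gh: "g \<in> I" "h \<in> I" "g \<noteq> h" and A: "A g p q" "A h p' q'" for g h p q p' q'
  proof
    assume qq: "t q q'"
    obtain l where l: "l \<in> L" using third by blast
    obtain l' where l': "l' \<in> L" "l' \<noteq> l" using third by blast
    obtain l'' where l'': "l'' \<in> L" "l'' \<noteq> l" "l'' \<noteq> l'" using third by blast
    note f = Afacts[OF gh(1) A(1)] and f' = Afacts[OF gh(2) A(2)]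
    have cb: "b g \<in> cell a c b g" "b h \<in> cell a c b h" by (auto simp: cell_def)
    have "p \<notin> L" "q \<notin> L" "p' \<notin> L" "q' \<notin> L" "b g \<notin> L" "b h \<notin> L"
      using notL[OF _ gh(1)] notL[OF _ gh(2)] f(8,9) f'(8,9) cb by blast+
    then have "v \<notin> L" if "v \<in> {p, q, p', q', b g, b h}" for v using that by auto
    then have nl: "\<forall>m\<in>{p, q, p', q', b g, b h}. m \<noteq> l \<and> m \<noteq> l' \<and> m \<noteq> l''"
      using l l'(1) l''(1) by metis
    note x = cross[OF f(8) f'(8) gh] cross[OF f(8) f'(9) gh] cross[OF f(9) f'(8) gh]
      cross[OF f(9) f'(9) gh] cross[OF f(8) cb(2) gh] cross[OF f(9) cb(2) gh]
      cross[OF cb(1) f'(8) gh] cross[OF cb(1) f'(9) gh] cross[OF cb gh]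
    have pl: "t p l" "t p' l'" using f(10) f'(10) l l' by (auto simp: full_def)
    have sub: "{p, q, b g} \<subseteq> cell a c b g" "{p', q', b h} \<subseteq> cell a c b h"
      using f(8,9) f'(8,9) cb by auto
    show False
    proof (cases "full (b g) L \<or> full (b h) L")
      case True
      then obtain r where r: "r = b g \<or> r = b h" "t r l''" using l''(1) by (auto simp: full_def)
      have "\<not> t q' p" "\<not> t q p'" using triangle f(1) f'(1) qq commute by blast+
      then have g1: "gull p l q'" "gull p' l' q"
        using pl f(2)[OF l'(1)] f'(2)[OF l] nl x by (auto intro!: gullI)
      show False
      proof (rule two[OF gh g1 _ _ r(2)])
        show "distinct [p, l, q', p', l', q, r, l'']"
          using r(1)
        proof
          assume "r = b g"
          then show ?thesis using f(5-7) f'(5-7) nl x l'(2) l''(2,3) by auto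
        next
          assume "r = b h"
          then show ?thesis using f(5-7) f'(5-7) nl x l'(2) l''(2,3) by auto
        qed
        show "set [p, l, q', p', l', q, r, l''] \<subseteq> L \<union> cell a c b g \<union> cell a c b h"
          using r(1) l(1) l'(1) l''(1) sub by auto
      qed
    next
      case False
      then have "\<not> t (b g) l" "\<not> t (b h) l'"
        using zero_or_full gh l l' by blast+
      then have g1: "gull p l (b g)" "gull p' l' (b h)"
        using pl f(3,5) f'(3,5) nl commute[of "b g"] commute[of "b h"] by (auto intro!: gullI)
      show False
      proof (rule two[OF gh g1 _ _ qq])
        show "distinct [p, l, b g, p', l', b h, q, q']"
          using f(5-7) f'(5-7) nl x l'(2) by auto
        show "set [p, l, b g, p', l', b h, q, q'] \<subseteq> L \<union> cell a c b g \<union> cell a c b h"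
          using l(1) l'(1) sub by auto
      qed
    qed
  qed
  have ww: "\<not> t (w g) (w h)" if gh: "g \<in> I" "h \<in> I" for g h
  proof (cases "g = h")
    case True then show ?thesis using irrefl by simp
  next
    case False
    have NA: "\<not> t (w g) (w h)" if gh: "g \<in> I" "h \<in> I" "g \<noteq> h" 
      and N: "w g = b g" "\<forall>l\<in>L. \<not> t (b g) l" "\<exists>l\<in>L. \<not> t (a g) l \<and> \<not> t (c g) l" for g h
    proof -
      have gg: "gull (a h) (c h) (b h)" using fam gh by (simp add: gull_family_def)
      have "\<exists>p\<in>cell a c b h. \<exists>q\<in>cell a c b h. p \<noteq> w h \<and> q \<noteq> w h \<and> t p q \<or> p \<noteq> w h \<and> full p L"
        using w_cases[OF gh(2)]
      proof
        assume "\<exists>p. A h p (w h)"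
        then obtain p where "A h p (w h)" by blast
        then show ?thesis using Afacts(7,8,10)[OF gh(2)] by metis
      next
        assume "w h = b h \<and> (\<forall>l\<in>L. \<not> t (b h) l) \<and> (\<exists>l\<in>L. \<not> t (a h) l \<and> \<not> t (c h) l)"
        then show ?thesis using gg gull_distinct[OF gg] 
          by (intro bexI[of _ "a h"] bexI[of _ "c h"]) (auto simp: gull_def cell_def)
      qed
      moreover have "\<forall>l\<in>L. \<not> t (w h) l"
        using w_cases[OF gh(2)] Afacts(2)[OF gh(2)] by metis
      ultimately show ?thesis using NN[OF gh N(2,3) wc] N(1) by simp
    qed
    show ?thesis
      using w_cases[OF gh(1)] w_cases[OF gh(2)] NA[OF gh False] NA[OF gh(2,1)] AA[OF gh False] False
        commute[of "w g" "w h"] by metis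
  qed
  have wL: "\<not> t (w g) l" if "g \<in> I" "l \<in> L" for g l
    using w_cases[OF that(1)] Afacts(2)[OF that(1) _ that(2)] that(2) by metis
  have "stable (L \<union> w ` I)"
    using Lst ww wL commute unfolding stable_def by (metis (no_types, lifting) Un_iff imageE)
  moreover have "inj_on w I"
    using wc cross by (meson inj_onI)
  then have "card (w ` I) = card I" by (rule card_image)
  moreover have "w ` I \<subseteq> (\<Union>i\<in>I. cell a c b i)" using wc by blast
  then have "L \<inter> w ` I = {}" "L \<union> w ` I \<subseteq> V" using L V by blast+
  moreover have "card (L \<union> w ` I) = card L + card (w ` I)"
    using card_Un_disjoint[OF finL _ calculation(3)] finI by simp
  ultimately show ?thesis using cV stable_gull_free
    by (intro exI[of _ "L \<union> w ` I"]) auto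
qed

text \<open>The cases differ in whether some \<open>p\<close> disjoint gulls leave an edge. If so,
  their remainder is gull-free by maximality and not stable, hence a biclique; if not, every
  remainder is stable.\<close>

theorem gull_packing:
  assumes fin: "finite V" and large: "3 * p + 3 \<le> card V" and p: "packs p V"
    and max: "\<not> packs (Suc p) V" and five: "p \<noteq> 1 \<or> card V \<noteq> 6"
  shows "\<exists>W\<subseteq>V. gull_free W \<and> card W + 2 * p = card V"
proof (cases "\<exists>u\<in>V. \<exists>v\<in>V. t u v \<and> packs p (V - {u, v})")
  case False
  obtain a c b where fam: "gull_family {..<p} a c b" "(\<Union>i<p. cell a c b i) \<subseteq> V"
    using family_packs[OF p] by blast
  show ?thesis
    using stable_remainder[OF fin, of "{..<p}" a c b "V - (\<Union>i<p. cell a c b i)"] fam large False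
    by auto
next
  case True
  then obtain u v where uv: "u \<in> V" "v \<in> V" "t u v" "packs p (V - {u, v})" by blast
  obtain a c b where fam: "gull_family {..<p} a c b" "(\<Union>i<p. cell a c b i) \<subseteq> V - {u, v}"
    using family_packs[OF uv(4)] by blast
  define L where "L = V - (\<Union>i<p. cell a c b i)"
  have "gull_free L"
  proof (rule ccontr)
    assume "\<not> gull_free L"
    then obtain x y z where g: "gull x y z" "{x, y, z} \<subseteq> L" by (auto simp: gull_free_def)
    have "packs (1 + card {..<p}) ({x, y, z} \<union> (\<Union>i<p. cell a c b i))"
      by (rule packs_Un[OF packs_1[OF g(1)] packs_family[OF fam(1)]]) (use g(2) L_def in auto)
    then have "packs (1 + card {..<p}) V"
      by (rule packs_mono) (use g(2) fam(2) L_def in auto)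
    then show False using max by (simp del: packs.simps)
  qed
  moreover have "u \<in> L" "v \<in> L" using uv fam(2) by (auto simp: L_def)
  then have "\<not> stable L" using uv(3) by (auto simp: stable_def)
  ultimately obtain X Y where XY: "biclique X Y" "X \<union> Y = L" by (metis gull_free_cases)
  interpret biclique_remainder t V "{..<p}" a c Y
    using fin large max five by unfold_locales simp_all
  have "state X b" unfolding state_def using fam XY by (auto simp: L_def)
  from gull_free_transversal[OF this] show ?thesis by simp
qed


section \<open>Small Ramsey numbers\<close>

lemma stable_subset: "stable S \<Longrightarrow> T \<subseteq> S \<Longrightarrow> stable T"
  by (auto simp: stable_def)

lemma stable_neighbours: "stable {u \<in> V. t v u}"
  using triangle commute unfolding stable_def by blast

lemma stable_insert:
  assumes "stable S" "\<And>u. u \<in> S \<Longrightarrow> \<not> t v u"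
  shows "stable (insert v S)"
  using assms irrefl commute unfolding stable_def by blast

lemma ramsey_step:
  assumes fin: "finite V" and v: "v \<in> V" and deg: "card {u \<in> V. t v u} \<le> d" and cV: "r + d + 1 \<le> card V"
    and r: "\<And>U. U \<subseteq> V \<Longrightarrow> r \<le> card U \<Longrightarrow> \<exists>S\<subseteq>U. stable S \<and> card S = s"
  shows "\<exists>S\<subseteq>V. stable S \<and> card S = Suc s"
proof -
  let ?N = "{u \<in> V. t v u}"
  have "card (insert v ?N) \<le> d + 1" using fin deg by (simp add: card_insert_if)
  moreover have "card (V - insert v ?N) = card V - card (insert v ?N)"
    using fin v by (intro card_Diff_subset) auto
  ultimately have "r \<le> card (V - insert v ?N)" using cV by simp
  with r[of "V - insert v ?N"] obtain S where S: "S \<subseteq> V - insert v ?N" "stable S" "card S = s" by auto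
  have "stable (insert v S)" using S by (intro stable_insert) auto
  moreover have "card (insert v S) = Suc s"
    using S finite_subset[OF _ fin, of S] by (subst card_insert_disjoint) auto
  ultimately show ?thesis using S(1) v by (intro exI[of _ "insert v S"]) auto
qed

lemma ramsey_degree:
  assumes fin: "finite V" and deg: "s \<le> card {u \<in> V. t v u}"
  shows "\<exists>S\<subseteq>V. stable S \<and> card S = s"
proof -
  obtain S where "S \<subseteq> {u \<in> V. t v u}" "card S = s"
    using obtain_subset_with_card_n[OF deg] by blast
  then show ?thesis using stable_subset[OF stable_neighbours] by (intro exI[of _ S]) auto
qed

text \<open>The recursion R(3, s + 1) \<le> R(3, s) + s + 1: neighbourhoods are stable, so a degree
  above \<open>s\<close> suffices at once, and a smaller degree leaves \<open>r\<close> vertices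
  outside the closed neighbourhood.\<close>

lemma ramsey_Suc:
  assumes fin: "finite V" and cV: "r + s + 1 \<le> card V"
    and r: "\<And>U. U \<subseteq> V \<Longrightarrow> r \<le> card U \<Longrightarrow> \<exists>S\<subseteq>U. stable S \<and> card S = s"
  shows "\<exists>S\<subseteq>V. stable S \<and> card S = Suc s"
proof -
  obtain v where v: "v \<in> V" using cV by fastforce
  show ?thesis
  proof (cases "card {u \<in> V. t v u} \<le> s")
    case True
    then show ?thesis using ramsey_step[OF fin v _ cV r] by blast
  next
    case False
    then show ?thesis using ramsey_degree[OF fin, of "Suc s" v] by simp
  qed
qed

lemma ramsey_2:
  assumes "finite V" "3 \<le> card V"
  shows "\<exists>S\<subseteq>V. stable S \<and> card S = 2"
proof -
  have one: "\<exists>S\<subseteq>U. stable S \<and> card S = 1" if U: "1 \<le> card U" for U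
  proof -
    obtain u where "u \<in> U" using U by fastforce
    then show ?thesis using irrefl by (intro exI[of _ "{u}"]) (auto simp: stable_def)
  qed
  show ?thesis using ramsey_Suc[OF assms(1), of 1 1] assms(2) one by (simp add: numeral_2_eq_2)
qed

lemma ramsey_3:
  assumes "finite V" "6 \<le> card V"
  shows "\<exists>S\<subseteq>V. stable S \<and> card S = 3"
proof -
  have "\<exists>S\<subseteq>U. stable S \<and> card S = 2" if "U \<subseteq> V" "3 \<le> card U" for U
    using that ramsey_2 finite_subset[OF _ assms(1)] by blast
  then have "\<exists>S\<subseteq>V. stable S \<and> card S = Suc 2"
    using assms by (intro ramsey_Suc[of V 3 2]) simp_all
  then show ?thesis by simp
qed

text \<open>A new vertex adds its degree twice, once for itself and once spread over its
  neighbours.\<close>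

lemma even_degree_sum:
  assumes "finite V"
  shows "even (\<Sum>u\<in>V. card {w \<in> V. t u w})"
  using assms
proof (induction V rule: finite_induct)
  case (insert x V)
  have x: "{w \<in> insert x V. t x w} = {w \<in> V. t x w}" using irrefl by auto
  have u: "card {w \<in> insert x V. t u w} = card {w \<in> V. t u w} + (if t x u then 1 else 0)" if "u \<in> V" for u
  proof (cases "t x u")
    case True
    then have "{w \<in> insert x V. t u w} = insert x {w \<in> V. t u w}" using commute by auto
    then show ?thesis using True insert.hyps by simp
  next
    case False
    then have "{w \<in> insert x V. t u w} = {w \<in> V. t u w}" using commute by auto
    then show ?thesis using False by simp
  qed
  have "(\<Sum>u\<in>V. if t x u then 1 else (0::nat)) = card {w \<in> V. t x w}"
    using insert.hyps(1) by (simp add: sum.If_cases Int_def)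
  moreover have "(\<Sum>u\<in>V. card {w \<in> insert x V. t u w}) =
      (\<Sum>u\<in>V. card {w \<in> V. t u w} + (if t x u then 1 else 0))"
    by (rule sum.cong[OF refl u])
  ultimately have "(\<Sum>u\<in>insert x V. card {w \<in> insert x V. t u w}) =
      2 * card {w \<in> V. t x w} + (\<Sum>u\<in>V. card {w \<in> V. t u w})"
    unfolding sum.insert[OF insert.hyps] x by (simp add: sum.distrib)
  then show ?case using insert.IH by simp
qed simp

text \<open>The recursion would only give 6 + 3 + 1 = 10. With nine vertices it fails only if all
  degrees equal 3, and their sum 27 is odd.\<close>

lemma ramsey_4:
  assumes fin: "finite V" and cV: "9 \<le> card V"
  shows "\<exists>S\<subseteq>V. stable S \<and> card S = 4"
proof -
  obtain U where U: "U \<subseteq> V" "card U = 9" using obtain_subset_with_card_n[OF cV] by blast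
  have finU: "finite U" using U fin finite_subset by blast
  have "\<exists>S\<subseteq>U. stable S \<and> card S = 4"
  proof (cases "\<exists>v\<in>U. card {u \<in> U. t v u} \<noteq> 3")
    case True
    then obtain v where v: "v \<in> U" "card {u \<in> U. t v u} \<noteq> 3" by blast
    have r: "\<exists>S\<subseteq>U'. stable S \<and> card S = 3" if "U' \<subseteq> U" "6 \<le> card U'" for U'
      using that ramsey_3 finite_subset[OF _ finU] by blast
    consider "card {u \<in> U. t v u} \<le> 2" | "4 \<le> card {u \<in> U. t v u}" using v(2) by linarith
    then show ?thesis
    proof cases
      case 1
      then show ?thesis using ramsey_step[OF finU v(1) 1, of 6 3] U(2) r by simp
    next
      case 2
      then show ?thesis using ramsey_degree[OF finU] by blast
    qed
  next
    case False
    then have "(\<Sum>u\<in>U. card {w \<in> U. t u w}) = 27" using U(2) by simp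
    then show ?thesis using even_degree_sum[OF finU] by simp
  qed
  then show ?thesis using U(1) by blast
qed

lemma ramsey_5:
  assumes "finite V" "14 \<le> card V"
  shows "\<exists>S\<subseteq>V. stable S \<and> card S = 5"
proof -
  have "\<exists>S\<subseteq>U. stable S \<and> card S = 4" if "U \<subseteq> V" "9 \<le> card U" for U
    using that ramsey_4 finite_subset[OF _ assms(1)] by blast
  then have "\<exists>S\<subseteq>V. stable S \<and> card S = Suc 4"
    using assms by (intro ramsey_Suc[of V 9 4]) simp_all
  then show ?thesis by simp
qed

section \<open>Maximum matchings\<close>

definition edges :: "'a set \<Rightarrow> 'a set set" where
  "edges V = {{u, v} | u v. u \<in> V \<and> v \<in> V \<and> t u v}"

definition matching :: "'a set \<Rightarrow> 'a set set \<Rightarrow> bool" where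
  "matching V M \<longleftrightarrow> M \<subseteq> edges V \<and> (\<forall>e\<in>M. \<forall>f\<in>M. e \<noteq> f \<longrightarrow> e \<inter> f = {})"

definition nu :: "'a set \<Rightarrow> nat" where
  "nu V = Max (card ` {M. matching V M})"

lemma edges_mono: "V \<subseteq> V' \<Longrightarrow> edges V \<subseteq> edges V'"
  by (auto simp: edges_def)

lemma card_edge: "e \<in> edges V \<Longrightarrow> card e = 2"
  by (auto simp: edges_def card_insert_if irrefl)

lemma matching_mono: "matching V M \<Longrightarrow> V \<subseteq> V' \<Longrightarrow> matching V' M"
  unfolding matching_def using edges_mono by (metis subset_trans)

lemma matching_subset: "matching V M \<Longrightarrow> N \<subseteq> M \<Longrightarrow> matching V N"
  by (simp add: matching_def subset_iff)

lemma matching_Union: "matching V M \<Longrightarrow> \<Union>M \<subseteq> V"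
  by (auto simp: matching_def edges_def)

lemma matching_disjoint: "matching V M \<Longrightarrow> e \<in> M \<Longrightarrow> f \<in> M \<Longrightarrow> e \<noteq> f \<Longrightarrow> e \<inter> f = {}"
  by (simp add: matching_def)

lemma matching_finite:
  assumes "finite V" "matching V M"
  shows "finite M"
proof -
  have "M \<subseteq> Pow V" using matching_Union[OF assms(2)] by blast
  then show ?thesis using assms(1) finite_subset by blast
qed

lemma card_matching:
  assumes "finite V" "matching V M"
  shows "card (\<Union>M) = 2 * card M"
proof -
  have e: "card e = 2" if "e \<in> M" for e using assms(2) that card_edge by (auto simp: matching_def)
  have "card (\<Union>M) = sum card M"
    using matching_disjoint[OF assms(2)] e
    by (intro card_Union_disjoint) (auto simp: pairwise_def disjnt_def intro: card_ge_0_finite)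
  also have "\<dots> = (\<Sum>e\<in>M. 2)" using e by (rule sum.cong[OF refl])
  finally show ?thesis by simp
qed

lemma finite_matchings: "finite V \<Longrightarrow> finite {M. matching V M}"
  by (rule finite_subset[of _ "Pow (Pow V)"]) (auto dest: matching_Union)

lemma matching_empty: "matching V {}"
  by (simp add: matching_def)

lemma nu_ge: "finite V \<Longrightarrow> matching V M \<Longrightarrow> card M \<le> nu V"
  unfolding nu_def using finite_matchings by (intro Max_ge) auto

lemma nu_attained:
  assumes "finite V"
  obtains M where "matching V M" "card M = nu V"
proof -
  have "nu V \<in> card ` {M. matching V M}"
    unfolding nu_def using finite_matchings[OF assms] matching_empty by (intro Max_in) auto
  then show thesis using that by auto
qed

lemma nu_le: "finite V \<Longrightarrow> 2 * nu V \<le> card V"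
  by (metis card_matching card_mono matching_Union nu_attained)

lemma matching_insert:
  assumes "matching V M" "u \<in> V" "v \<in> V" "t u v" "u \<notin> \<Union>M" "v \<notin> \<Union>M"
  shows "matching V (insert {u, v} M)"
proof -
  have "{u, v} \<in> edges V" using assms by (auto simp: edges_def)
  moreover have "{u, v} \<inter> e = {}" if "e \<in> M" for e using assms(5,6) that by blast
  ultimately show ?thesis using assms(1) by (auto simp: matching_def)
qed

text \<open>The relation of Gallai's lemma. It contains adjacency, and once every vertex is missed
  by some maximum matching it is transitive, so it relates all vertices of a component.\<close>

definition linked :: "'a set \<Rightarrow> 'a \<Rightarrow> 'a \<Rightarrow> bool" where
  "linked V u v \<longleftrightarrow>
     (\<forall>M. matching V M \<longrightarrow> card M = nu V \<longrightarrow> u \<notin> \<Union>M \<longrightarrow> v \<notin> \<Union>M \<longrightarrow> u = v)"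

lemma adjacent_linked:
  assumes fin: "finite V" and uv: "u \<in> V" "v \<in> V" "t u v"
  shows "linked V u v"
  unfolding linked_def
proof (intro allI impI)
  fix M assume M: "matching V M" "card M = nu V" "u \<notin> \<Union>M" "v \<notin> \<Union>M"
  have "{u, v} \<notin> M" using M by blast
  then have "card (insert {u, v} M) = Suc (nu V)"
    using M(2) matching_finite[OF fin M(1)] by simp
  then show "u = v"
    using nu_ge[OF fin matching_insert[OF M(1) uv M(3,4)]] by simp
qed

text \<open>The exchange step of Gallai's lemma: given a maximum matching \<open>M\<close> missing both \<open>u\<close> and \<open>v\<close>,
  a maximum matching missing \<open>w\<close> that shares as many edges as possible with \<open>M\<close> could be changed to
  share one more.\<close>

lemma linked_trans:
  assumes fin: "finite V" and uw: "linked V u w" and wv: "linked V w v"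
    and miss: "\<exists>N. matching V N \<and> card N = nu V \<and> w \<notin> \<Union>N"
    and V: "u \<in> V" "v \<in> V" "w \<in> V"
  shows "linked V u v"
proof (rule ccontr)
  assume "\<not> linked V u v"
  then obtain M where M: "matching V M" "card M = nu V" "u \<notin> \<Union>M" "v \<notin> \<Union>M" and uv: "u \<noteq> v"
    by (auto simp: linked_def)
  have finM: "finite M" by (rule matching_finite[OF fin M(1)])
  define P where "P N \<longleftrightarrow> matching V N \<and> card N = nu V \<and> w \<notin> \<Union>N" for N
  have "\<exists>N. P N \<and> (\<forall>N'. P N' \<longrightarrow> card (M \<inter> N') \<le> card (M \<inter> N))"
  proof -
    obtain N where "P N" using miss P_def by auto
    moreover have "\<forall>N'. P N' \<longrightarrow> card (M \<inter> N') < Suc (card M)"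
      by (intro allI impI le_imp_less_Suc card_mono[OF finM]) auto
    ultimately show ?thesis by (rule ex_has_greatest_nat[where f = "\<lambda>N. card (M \<inter> N)"])
  qed
  then obtain N where N: "matching V N" "card N = nu V" "w \<notin> \<Union>N"
    and best: "\<And>N'. P N' \<Longrightarrow> card (M \<inter> N') \<le> card (M \<inter> N)"
    unfolding P_def by metis
  have finN: "finite N" by (rule matching_finite[OF fin N(1)])
  have wne: "w \<noteq> u" "w \<noteq> v"
    using uv uw wv M unfolding linked_def by metis+
  have wM: "w \<in> \<Union>M" using uw M wne unfolding linked_def by metis
  have uN: "u \<in> \<Union>N" "v \<in> \<Union>N" using uw wv N wne unfolding linked_def by metis+
  have fU: "finite (\<Union>M)" "finite (\<Union>N)"
    using matching_Union[OF M(1)] matching_Union[OF N(1)] fin finite_subset by blast+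
  have eq: "card (\<Union>M) = card (\<Union>N)" using card_matching[OF fin] M N by simp
  \<comment> \<open>\<open>M\<close> and \<open>N\<close> cover equally many vertices, and
    \<open>N\<close> covers \<open>u\<close> and \<open>v\<close>, which \<open>M\<close> misses.
    Hence \<open>M\<close> covers at least two vertices that \<open>N\<close> misses, one of them
    other than \<open>w\<close>.\<close>
  have "\<exists>x. x \<in> \<Union>M \<and> x \<notin> \<Union>N \<and> x \<noteq> w"
  proof (rule ccontr)
    assume "\<not> ?thesis"
    then have "\<Union>M \<subseteq> insert w (\<Union>N - {u, v})" using M(3,4) by blast
    then have "card (\<Union>M) \<le> card (insert w (\<Union>N - {u, v}))"
      using fU by (intro card_mono) auto
    also have "\<dots> \<le> Suc (card (\<Union>N - {u, v}))" by (rule card_insert_le_m1) simp_all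
    also have "card (\<Union>N - {u, v}) = card (\<Union>N) - 2"
      using uN uv fU by (subst card_Diff_subset) auto
    finally have "card (\<Union>N) \<le> 1" using eq by linarith
    moreover have "card {u, v} \<le> card (\<Union>N)" using uN fU by (intro card_mono) auto
    ultimately show False using uv by simp
  qed
  then obtain x where x: "x \<in> \<Union>M" "x \<notin> \<Union>N" "x \<noteq> w" by blast
  then obtain e where e: "e \<in> M" "x \<in> e" by blast
  have "e \<in> edges V" using M(1) e(1) by (auto simp: matching_def)
  then obtain p q where "e = {p, q}" "t p q" "p \<in> V" "q \<in> V" by (auto simp: edges_def)
  then obtain y where y: "e = {x, y}" "t x y" "x \<in> V" "y \<in> V"
    using e(2) sym[of p q] by (cases "x = p") auto
  have yN: "y \<in> \<Union>N"
  proof (rule ccontr)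
    assume "y \<notin> \<Union>N"
    then have "matching V (insert e N)" using matching_insert[OF N(1) y(3,4,2) x(2)] y(1) by simp
    moreover have "e \<notin> N" using x(2) e(2) by blast
    ultimately show False using nu_ge[OF fin, of "insert e N"] N(2) finN by simp
  qed
  then obtain f where f: "f \<in> N" "y \<in> f" by blast
  have ynw: "y \<noteq> w" using yN N(3) by metis
  define N' where "N' = insert e (N - {f})"
  have disj: "f \<inter> g = {}" if "g \<in> N" "g \<noteq> f" for g
    using matching_disjoint[OF N(1) f(1) that(1)] that(2) by simp
  have m1: "matching V (N - {f})" by (rule matching_subset[OF N(1)]) blast
  have "y \<notin> \<Union>(N - {f})" using disj f by blast
  then have "matching V N'" unfolding N'_def y(1)
    using x(2) by (intro matching_insert[OF m1 y(3,4,2)]) auto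
  moreover have eN: "e \<notin> N" using x(2) e(2) by blast
  then have "card N' = nu V"
    unfolding N'_def using card_Suc_Diff1[OF finN f(1)] N(2) finN by simp
  moreover have "w \<notin> \<Union>N'" unfolding N'_def y(1) using N(3) x(3) ynw by blast
  ultimately have "P N'" by (simp add: P_def)
  moreover have "card (M \<inter> N) < card (M \<inter> N')"
  proof -
    have "f \<notin> M"
    proof
      assume "f \<in> M"
      moreover have "f \<noteq> e" using f(1) eN by blast
      ultimately have "f \<inter> e = {}" using matching_disjoint[OF M(1) _ e(1)] by simp
      then show False using f(2) y(1) by blast
    qed
    then have "M \<inter> N' = insert e (M \<inter> N)" using e(1) by (auto simp: N'_def)
    then show ?thesis using finM eN by simp
  qed
  ultimately show False using best[of N'] by simp
qed


section \<open>Clique minors\<close>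

definition joined :: "'a set \<Rightarrow> 'a set \<Rightarrow> bool" where
  "joined A B \<longleftrightarrow> (\<exists>u\<in>A. \<exists>v\<in>B. u \<noteq> v \<and> \<not> t u v)"

definition branch :: "'a set \<Rightarrow> bool" where
  "branch B \<longleftrightarrow> (\<exists>v. B = {v}) \<or> (\<exists>a c b. gull a c b \<and> B = {a, c, b})"

definition model :: "'a set \<Rightarrow> nat \<Rightarrow> bool" where
  "model V s \<longleftrightarrow> (\<exists>F. finite F \<and> card F = s \<and> (\<forall>B\<in>F. branch B \<and> B \<subseteq> V) \<and>
     (\<forall>A\<in>F. \<forall>B\<in>F. A \<noteq> B \<longrightarrow> A \<inter> B = {} \<and> joined A B))"

lemma joined_commute: "joined A B \<longleftrightarrow> joined B A"
  unfolding joined_def using commute by metis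

lemma branch_nonempty: "branch B \<Longrightarrow> B \<noteq> {}"
  by (auto simp: branch_def)

lemma modelI:
  assumes "finite F" "card F = s" "\<And>B. B \<in> F \<Longrightarrow> branch B \<and> B \<subseteq> V"
    "\<And>A B. A \<in> F \<Longrightarrow> B \<in> F \<Longrightarrow> A \<noteq> B \<Longrightarrow> A \<inter> B = {} \<and> joined A B"
  shows "model V s"
  unfolding model_def using assms by (intro exI[of _ F]) simp

lemma modelE:
  assumes "model V s"
  obtains F where "finite F" "card F = s" "\<And>B. B \<in> F \<Longrightarrow> branch B \<and> B \<subseteq> V"
    "\<And>A B. A \<in> F \<Longrightarrow> B \<in> F \<Longrightarrow> A \<noteq> B \<Longrightarrow> A \<inter> B = {} \<and> joined A B"
proof -
  from assms obtain F where "finite F \<and> card F = s \<and> (\<forall>B\<in>F. branch B \<and> B \<subseteq> V) \<and>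
      (\<forall>A\<in>F. \<forall>B\<in>F. A \<noteq> B \<longrightarrow> A \<inter> B = {} \<and> joined A B)"
    unfolding model_def by (rule exE)
  then show thesis by (intro that[of F]) simp_all
qed

lemma model_mono:
  assumes "model V s" "V \<subseteq> V'"
  shows "model V' s"
proof -
  obtain F where F: "finite F" "card F = s" "\<And>B. B \<in> F \<Longrightarrow> branch B \<and> B \<subseteq> V"
    "\<And>A B. A \<in> F \<Longrightarrow> B \<in> F \<Longrightarrow> A \<noteq> B \<Longrightarrow> A \<inter> B = {} \<and> joined A B"
    using modelE[OF assms(1)] by metis
  show ?thesis by (rule modelI[OF F(1,2) _ F(4)]) (use F(3) assms(2) in \<open>auto dest!: subsetD\<close>)
qed

lemma model_le:
  assumes "model V s" "s' \<le> s"
  shows "model V s'"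
proof -
  obtain F where F: "finite F" "card F = s" "\<And>B. B \<in> F \<Longrightarrow> branch B \<and> B \<subseteq> V"
    "\<And>A B. A \<in> F \<Longrightarrow> B \<in> F \<Longrightarrow> A \<noteq> B \<Longrightarrow> A \<inter> B = {} \<and> joined A B"
    using modelE[OF assms(1)] by metis
  obtain F' where F': "F' \<subseteq> F" "card F' = s'" "finite F'"
    using obtain_subset_with_card_n[of s' F] F(2) assms(2) by metis
  show ?thesis by (rule modelI[OF F'(3,2)]) (use F' F in \<open>blast dest: subsetD\<close>)+
qed

lemma model_Un:
  assumes A: "model A m" and B: "model B n" and dis: "A \<inter> B = {}"
    and join: "\<And>u v. u \<in> A \<Longrightarrow> v \<in> B \<Longrightarrow> \<not> t u v"
  shows "model (A \<union> B) (m + n)"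
proof -
  obtain F where F: "finite F" "card F = m" "\<And>C. C \<in> F \<Longrightarrow> branch C \<and> C \<subseteq> A"
      "\<And>C D. C \<in> F \<Longrightarrow> D \<in> F \<Longrightarrow> C \<noteq> D \<Longrightarrow> C \<inter> D = {} \<and> joined C D"
    using modelE[OF A] by metis
  obtain F' where F': "finite F'" "card F' = n" "\<And>C. C \<in> F' \<Longrightarrow> branch C \<and> C \<subseteq> B"
      "\<And>C D. C \<in> F' \<Longrightarrow> D \<in> F' \<Longrightarrow> C \<noteq> D \<Longrightarrow> C \<inter> D = {} \<and> joined C D"
    using modelE[OF B] by metis
  have cross: "C \<inter> D = {} \<and> joined C D" if C: "C \<in> F" and D: "D \<in> F'" for C D
  proof -
    obtain u v where uv: "u \<in> C" "v \<in> D"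
      using F(3)[OF C] F'(3)[OF D] branch_nonempty by (metis ex_in_conv)
    then have "u \<in> A" "v \<in> B" using F(3)[OF C] F'(3)[OF D] by blast+
    then have "u \<noteq> v" "\<not> t u v" using join dis by auto
    then have "joined C D" using uv unfolding joined_def by blast
    moreover have "C \<inter> D = {}" using F(3)[OF C] F'(3)[OF D] dis by blast
    ultimately show ?thesis by simp
  qed
  have "F \<inter> F' = {}"
  proof (rule ccontr)
    assume "F \<inter> F' \<noteq> {}"
    then obtain C where "C \<in> F" "C \<in> F'" by blast
    then show False using cross[of C C] F(3)[of C] branch_nonempty by auto
  qed
  then have "card (F \<union> F') = m + n" using F F' by (simp add: card_Un_disjoint)
  moreover have "branch C \<and> C \<subseteq> A \<union> B" if "C \<in> F \<union> F'" for C using that F(3) F'(3) by blast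
  moreover have "C \<inter> D = {} \<and> joined C D" if "C \<in> F \<union> F'" "D \<in> F \<union> F'" "C \<noteq> D" for C D
    using that(1,2)
  proof (elim UnE)
    assume "C \<in> F'" "D \<in> F"
    then show ?thesis using cross[of D C] joined_commute[of C D] by blast
  qed (use F(4) F'(4) cross that(3) in blast)+
  ultimately show ?thesis using F(1) F'(1) by (intro modelI[of "F \<union> F'"]) simp_all
qed

text \<open>A gull dominates because a vertex seeing both \<open>a\<close> and \<open>c\<close>
  would close a triangle of \<open>t\<close>.\<close>

lemma gull_joined:
  assumes "gull a c b" "v \<notin> {a, c, b}"
  shows "joined {a, c, b} {v}"
proof -
  have "\<not> t a v \<or> \<not> t c v" using assms(1) triangle[of a c v] by (auto simp: gull_def)
  then show ?thesis using assms(2) by (auto simp: joined_def)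
qed

lemma joined_superset: "joined A B \<Longrightarrow> B \<subseteq> B' \<Longrightarrow> joined A B'"
  unfolding joined_def by blast

lemma model_stable_gulls:
  assumes fin: "finite V" and Z: "Z \<subseteq> V" "stable Z" and k: "packs k (V - Z)"
  shows "model V (card Z + k)"
proof -
  obtain a c b :: "nat \<Rightarrow> 'a" where fam: "gull_family {..<k} a c b"
    and sub: "(\<Union>i<k. cell a c b i) \<subseteq> V - Z"
    using family_packs[OF k] by blast
  have finZ: "finite Z" using Z(1) fin finite_subset by blast
  let ?S = "(\<lambda>z. {z}) ` Z" and ?C = "cell a c b ` {..<k}"
  have gull: "gull (a i) (c i) (b i)" if "i < k" for i using fam that by (simp add: gull_family_def)
  have disj: "cell a c b i \<inter> cell a c b j = {}" if "i < k" "j < k" "i \<noteq> j" for i j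
    using fam that by (simp add: gull_family_def)
  have mem: "b i \<in> cell a c b i" for i by (simp add: cell_def)
  have subi: "cell a c b i \<subseteq> V - Z" if "i < k" for i using sub that by blast
  have jo: "joined (cell a c b i) D" if "i < k" "v \<in> D" "v \<notin> cell a c b i" for i v D
  proof -
    have "joined (cell a c b i) {v}" using gull_joined[OF gull[OF that(1)]] that(3) by (simp add: cell_def)
    then show ?thesis by (rule joined_superset) (use that(2) in simp)
  qed
  have inj: "inj_on (cell a c b) {..<k}"
    using disj mem by (intro inj_onI) (metis IntI empty_iff lessThan_iff)
  have "?S \<inter> ?C = {}"
  proof -
    have "{z} \<noteq> cell a c b i" if "z \<in> Z" "i < k" for z i using subi[OF that(2)] that(1) by blast
    then show ?thesis by blast
  qed
  then have card: "card (?S \<union> ?C) = card Z + k"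
    using finZ card_image[OF inj] by (simp add: card_Un_disjoint card_image)
  have br: "branch B \<and> B \<subseteq> V" if B: "B \<in> ?S \<union> ?C" for B
    using B
  proof
    assume "B \<in> ?S"
    then show ?thesis using Z(1) by (auto simp: branch_def)
  next
    assume "B \<in> ?C"
    then obtain i where i: "i < k" "B = cell a c b i" by auto
    have "branch B" using gull[OF i(1)] unfolding i(2) branch_def cell_def by blast
    then show ?thesis using subi[OF i(1)] i(2) by blast
  qed
  have SC: "A \<inter> B = {} \<and> joined A B \<and> joined B A" if A: "A \<in> ?S" and B: "B \<in> ?C" for A B
  proof -
    obtain z where z: "z \<in> Z" "A = {z}" using A by auto
    obtain i where i: "i < k" "B = cell a c b i" using B by auto
    have "z \<notin> B" using subi[OF i(1)] z(1) i(2) by blast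
    then show ?thesis using jo[OF i(1), of z A] z(2) i(2) joined_commute[of A B] by simp
  qed
  have pair: "A \<inter> B = {} \<and> joined A B" if A: "A \<in> ?S \<union> ?C" and B: "B \<in> ?S \<union> ?C" and ne: "A \<noteq> B" for A B
    using A B
  proof (elim UnE)
    assume "A \<in> ?S" "B \<in> ?S"
    then show ?thesis using ne Z(2) by (auto simp: joined_def stable_def)
  next
    assume "A \<in> ?C" "B \<in> ?C"
    then obtain i j where ij: "i < k" "A = cell a c b i" "j < k" "B = cell a c b j" by auto
    then have d: "A \<inter> B = {}" using disj[of i j] ne by auto
    then have "b j \<notin> A" "b j \<in> B" using mem[of j] ij(4) by auto
    then have "joined A B" using jo[OF ij(1)] ij(2) by blast
    with d show ?thesis by simp
  next
    assume "A \<in> ?S" "B \<in> ?C"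
    then show ?thesis using SC by blast
  next
    assume "A \<in> ?C" "B \<in> ?S"
    then show ?thesis using SC[of B A] by blast
  qed
  show ?thesis by (rule modelI[OF _ card br pair]) (use finZ in simp_all)
qed

lemma stable_Un:
  assumes "stable A" "stable B" "\<And>u v. u \<in> A \<Longrightarrow> v \<in> B \<Longrightarrow> \<not> t v u"
  shows "stable (A \<union> B)"
proof -
  have "\<not> t u v" if "u \<in> A \<union> B" "v \<in> A \<union> B" for u v
    using that assms(3)[of u v] assms(3)[of v u] assms(1,2) commute[of u v] by (auto simp: stable_def)
  then show ?thesis by (simp add: stable_def)
qed

text \<open>The stable sets \<open>X \<union> ZX\<close> and \<open>Y \<union> (Z - ZX)\<close> have
  \<open>card W + card Z\<close> elements together and at most \<open>card Z\<close> each.\<close>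

lemma gull_free_card:
  assumes fin: "finite V" and Z: "Z \<subseteq> V" "stable Z"
    and max: "\<And>S. S \<subseteq> V \<Longrightarrow> stable S \<Longrightarrow> card S \<le> card Z"
    and W: "W \<subseteq> V - Z" "gull_free W"
  shows "card W \<le> card Z"
  using W(2)
proof (cases rule: gull_free_cases)
  case 1
  then show ?thesis using max W(1) by blast
next
  case (2 X Y)
  have finWZ: "finite W" "finite Z" using W(1) Z(1) fin finite_subset by blast+
  define ZX where "ZX = {z \<in> Z. \<forall>x\<in>X. \<not> t z x}"
  have st: "stable X" "stable Y"
    using biclique_stable[OF 2(1)] biclique_stable[OF biclique_swap[OF 2(1)]] by (auto simp: stable_def)
  have ZY: "\<not> t z y" if "z \<in> Z - ZX" "y \<in> Y" for z y
  proof -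
    have "\<exists>x\<in>X. t z x" using that(1) by (auto simp: ZX_def)
    then obtain x where "x \<in> X" "t z x" by blast
    moreover have "t x y" using 2(1) that(2) \<open>x \<in> X\<close> by (simp add: biclique_def)
    ultimately show ?thesis using triangle[of z x y] by simp
  qed
  have "stable ZX" "stable (Z - ZX)"
    by (rule stable_subset[OF Z(2)], auto simp: ZX_def)+
  have "\<not> t v u" if "u \<in> X" "v \<in> ZX" for u v using that by (simp add: ZX_def)
  then have s: "stable (X \<union> ZX)" by (rule stable_Un[OF st(1) \<open>stable ZX\<close>])
  have s': "stable (Y \<union> (Z - ZX))" by (rule stable_Un[OF st(2) \<open>stable (Z - ZX)\<close> ZY])
  have sub: "X \<subseteq> V" "Y \<subseteq> V" "ZX \<subseteq> V" "Z - ZX \<subseteq> V"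
    using 2(2) W(1) Z(1) by (auto simp: ZX_def)
  have le: "card (X \<union> ZX) \<le> card Z" "card (Y \<union> (Z - ZX)) \<le> card Z"
    by (rule max[OF _ s], use sub in simp, rule max[OF _ s'], use sub in simp)
  have fXY: "finite X" "finite Y" "finite ZX" using 2(2) finWZ by (auto simp: ZX_def)
  have "X \<inter> Z = {}" "Y \<inter> Z = {}" using 2(2) W(1) by blast+
  then have "card (X \<union> ZX) = card X + card ZX" "card (Y \<union> (Z - ZX)) = card Y + card (Z - ZX)"
    using fXY finWZ by (auto intro!: card_Un_disjoint simp: ZX_def)
  moreover have "card ZX + card (Z - ZX) = card Z"
    using finWZ(2) by (subst card_Un_disjoint[symmetric]) (auto simp: ZX_def intro: arg_cong[where f = card])
  moreover have "card W = card X + card Y"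
    using 2 biclique_disjoint[OF 2(1)] fXY card_Un_disjoint by metis
  ultimately show ?thesis using le by linarith
qed

lemma odd_model:
  assumes fin: "finite V" and odd: "card V = 2 * m + 1"
    and Z0: "Z0 \<subseteq> V" "stable Z0" "33 * card V \<le> 124 * card Z0"
  shows "model V (m + 1)"
proof -
  define P where "P Z \<longleftrightarrow> Z \<subseteq> V \<and> stable Z" for Z
  have "P Z0" using Z0 by (simp add: P_def)
  moreover have "\<forall>Z. P Z \<longrightarrow> card Z < Suc (card V)"
    using fin by (auto simp: P_def le_imp_less_Suc card_mono)
  ultimately have "\<exists>Z. P Z \<and> (\<forall>Z'. P Z' \<longrightarrow> card Z' \<le> card Z)" by (rule ex_has_greatest_nat[where f = card])
  then obtain Z where Z: "Z \<subseteq> V" "stable Z" and max: "\<And>S. S \<subseteq> V \<Longrightarrow> stable S \<Longrightarrow> card S \<le> card Z"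
    unfolding P_def by blast
  define w where "w = card Z"
  have ram: "s \<le> w" if ex: "\<exists>S\<subseteq>V. stable S \<and> card S = s" for s
  proof -
    obtain S where "S \<subseteq> V" "stable S" "card S = s" using ex by blast
    then show ?thesis using max[of S] by (simp add: w_def)
  qed
  have w2: "3 \<le> card V \<Longrightarrow> 2 \<le> w" "6 \<le> card V \<Longrightarrow> 3 \<le> w" "9 \<le> card V \<Longrightarrow> 4 \<le> w" "14 \<le> card V \<Longrightarrow> 5 \<le> w"
    using ram[OF ramsey_2[OF fin]] ram[OF ramsey_3[OF fin]] ram[OF ramsey_4[OF fin]]
      ram[OF ramsey_5[OF fin]] by simp_all
  have "33 * (2 * m + 1) \<le> 124 * w" using Z0(3) max[OF Z0(1,2)] odd by (simp add: w_def)
  then have w: "66 * m + 33 \<le> 124 * w" by simp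
  \<comment> \<open>For \<open>m \<ge> 8\<close> one has \<open>62 * (m + 1) < 66 * m + 33\<close>;
    at \<open>m = 7\<close> this fails by one. The Ramsey bounds cover \<open>m\<close> from 1 to 7,
    and \<open>m = 0\<close> only needs \<open>w\<close> to be positive.\<close>
  have big: "m + 2 \<le> 2 * w"
  proof (cases "8 \<le> m")
    case True
    show ?thesis
    proof (rule ccontr)
      assume "\<not> ?thesis"
      then have "2 * w \<le> m + 1" by simp
      then have "62 * (2 * w) \<le> 62 * (m + 1)" by (rule mult_le_mono2)
      then show False using w True by simp
    qed
  next
    case False
    then have "m \<in> {0, 1, 2, 3, 4, 5, 6, 7}" by auto
    then show ?thesis using w2 w odd by (auto; presburger)
  qed
  show ?thesis
  proof (cases "packs (m + 1 - w) (V - Z)")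
    case True
    have "model V (w + (m + 1 - w))" using model_stable_gulls[OF fin Z True] by (simp add: w_def)
    then show ?thesis by (rule model_le) simp
  next
    case False
    have H: "card (V - Z) = 2 * m + 1 - w" using odd Z(1) fin finite_subset[OF Z(1) fin] by (simp add: card_Diff_subset w_def)
    \<comment> \<open>The least failing number is positive, as \<open>packs 0\<close> always holds;
      its predecessor is the size of a maximum packing.\<close>
    define p where "p = (LEAST k. \<not> packs k (V - Z)) - 1"
    have least: "\<not> packs (LEAST k. \<not> packs k (V - Z)) (V - Z)" by (rule LeastI[of "\<lambda>k. \<not> packs k (V - Z)", OF False])
    then have pos: "(LEAST k. \<not> packs k (V - Z)) \<noteq> 0" by (metis packs.simps(1))
    have "(LEAST k. \<not> packs k (V - Z)) \<le> m + 1 - w" by (rule Least_le) (rule False)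
    then have p: "Suc p \<le> m + 1 - w" "\<not> packs (Suc p) (V - Z)" using least pos by (simp_all add: p_def)
    have pp: "packs p (V - Z)"
      using not_less_Least[of p "\<lambda>k. \<not> packs k (V - Z)"] pos by (simp add: p_def)
    have "\<exists>W\<subseteq>V - Z. gull_free W \<and> card W + 2 * p = card (V - Z)"
    proof (rule gull_packing[OF _ _ pp p(2)])
      show "finite (V - Z)" using fin by simp
      \<comment> \<open>With \<open>p \<le> m - w\<close> it is enough that
        \<open>3 * (m - w) + 3 \<le> 2 * m + 1 - w\<close>, which is \<open>big\<close>
        rearranged.\<close>
      show "3 * p + 3 \<le> card (V - Z)" using H p(1) big by linarith
      show "p \<noteq> 1 \<or> card (V - Z) \<noteq> 6"
      proof (rule ccontr)
        assume "\<not> ?thesis"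
        then have "p = 1" "2 * m + 1 - w = 6" using H by auto
        \<comment> \<open>From \<open>w = 2 * m - 5\<close> the bound on \<open>Suc p\<close> gives
          \<open>m \<le> 4\<close> and \<open>big\<close> gives \<open>m \<ge> 4\<close>. But nine
          vertices contain a stable set of size four.\<close>
        then have "m = 4" "w = 3" using p(1) big by linarith+
        then show False using w2(3) odd by simp
      qed
    qed
    then obtain W where W: "W \<subseteq> V - Z" "gull_free W" "card W + 2 * p = card (V - Z)" by blast
    \<comment> \<open>On the other hand \<open>card W = 2 * m + 1 - w - 2 * p\<close>, which is at
      least \<open>w + 1\<close> because \<open>p \<le> m - w\<close>.\<close>
    have "card W \<le> w" unfolding w_def by (rule gull_free_card[OF fin Z _ W(1,2)]) (rule max)
    moreover have "p + w \<le> m" using p(1) by simp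
    then have "card (V - Z) + w = 2 * m + 1" using H by simp
    ultimately have False using W(3) \<open>p + w \<le> m\<close> by linarith
    then show ?thesis ..
  qed
qed

text \<open>The bound is required for every \<open>U \<subseteq> V\<close> so that the induction can
  pass to \<open>V - {v}\<close> and to the two parts of a disconnected \<open>t\<close>.\<close>

theorem clique_model:
  assumes fin: "finite V" and big: "\<And>U. U \<subseteq> V \<Longrightarrow> \<exists>Z\<subseteq>U. stable Z \<and> 33 * card U \<le> 124 * card Z"
  shows "model V (card V - nu V)"
  using assms
proof (induction "card V" arbitrary: V rule: less_induct)
  case less
  note fin = less.prems(1)
  have IH: "model U (card U - nu U)" if U: "U \<subset> V" for U
  proof (rule less.hyps)
    show "card U < card V" by (rule psubset_card_mono[OF fin U])
    show "finite U" using U fin finite_subset by blast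
    show "\<exists>Z\<subseteq>U'. stable Z \<and> 33 * card U' \<le> 124 * card Z" if "U' \<subseteq> U" for U'
      by (rule less.prems(2)) (use that U in simp)
  qed
  show ?case
  proof (cases "\<exists>v\<in>V. nu (V - {v}) < nu V")
    case True
    then obtain v where v: "v \<in> V" "nu (V - {v}) < nu V" by blast
    \<comment> \<open>Deleting \<open>v\<close> lowers both the order and \<open>nu\<close>, so
      their difference does not drop.\<close>
    have "model (V - {v}) (card (V - {v}) - nu (V - {v}))" using v(1) by (intro IH) auto
    then have "model V (card (V - {v}) - nu (V - {v}))" by (rule model_mono) auto
    then show ?thesis by (rule model_le) (use v fin in simp)
  next
    case False
    have miss: "\<exists>M. matching V M \<and> card M = nu V \<and> v \<notin> \<Union>M" if v: "v \<in> V" for v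
    proof -
      obtain M where M: "matching (V - {v}) M" "card M = nu (V - {v})"
        using nu_attained[of "V - {v}"] fin by auto
      have M': "matching V M" using matching_mono[OF M(1)] by blast
      have "card M = nu V" using nu_ge[OF fin M'] M(2) False v by force
      then show ?thesis using M' matching_Union[OF M(1)] by blast
    qed
    show ?thesis
    proof (cases "V = {}")
      case True
      then show ?thesis by (auto simp: model_def)
    next
      case False
      then obtain v0 where v0: "v0 \<in> V" by blast
      \<comment> \<open>By \<open>adjacent_linked\<close> and \<open>linked_trans\<close> no edge
        leaves \<open>A\<close>. If \<open>A\<close> is everything, a maximum matching missing
        \<open>v0\<close> covers all other vertices, which gives the odd case; otherwise the two
        parts are completely joined in the graph.\<close>
      define A where "A = {u \<in> V. linked V v0 u}"
      have v0A: "v0 \<in> A" using v0 by (simp add: A_def linked_def)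
      show ?thesis
      proof (cases "A = V")
        case True
        obtain M where M: "matching V M" "card M = nu V" "v0 \<notin> \<Union>M" using miss[OF v0] by blast
        have "u \<in> \<Union>M" if "u \<in> V" "u \<noteq> v0" for u
          using that True M unfolding A_def linked_def by blast
        then have V: "V = insert v0 (\<Union>M)" using matching_Union[OF M(1)] v0 by blast
        moreover have "finite (\<Union>M)" using matching_Union[OF M(1)] fin finite_subset by blast
        ultimately have "card V = Suc (card (\<Union>M))" using M(3) by (metis card_insert_disjoint)
        then have c: "card V = 2 * nu V + 1" using card_matching[OF fin M(1)] M(2) by simp
        obtain Z where "Z \<subseteq> V" "stable Z" "33 * card V \<le> 124 * card Z" using less.prems(2)[of V] by auto
        from odd_model[OF fin c this] show ?thesis using c by simp
      next
        case False
        have AV: "A \<subset> V" using False by (auto simp: A_def)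
        have BV: "V - A \<subset> V" using v0A v0 by blast
        have no: "\<not> t u v" if u: "u \<in> A" and v: "v \<in> V - A" for u v
        proof
          assume "t u v"
          then have "linked V u v" using adjacent_linked[OF fin] u v AV by blast
          then have "linked V v0 v"
            using linked_trans[OF fin _ _ miss[of u], of v0 v] u v v0 by (auto simp: A_def)
          then show False using v by (simp add: A_def)
        qed
        have finAB: "finite A" "finite (V - A)" using fin AV finite_subset by auto
        obtain M where M: "matching A M" "card M = nu A" using nu_attained[OF finAB(1)] by blast
        obtain N where N: "matching (V - A) N" "card N = nu (V - A)" using nu_attained[OF finAB(2)] by blast
        have MN: "e \<inter> f = {}" "e \<noteq> {}" if "e \<in> M" "f \<in> N" for e f
        proof -
          show "e \<inter> f = {}" using matching_Union[OF M(1)] matching_Union[OF N(1)] that by blast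
          show "e \<noteq> {}" using M(1) that(1) by (auto simp: matching_def edges_def)
        qed
        have "matching V M" "matching V N" using matching_mono[OF M(1)] matching_mono[OF N(1)] AV by auto
        then have "matching V (M \<union> N)" using MN(1) unfolding matching_def
          by (simp add: ball_Un Int_commute) (metis Int_commute)
        moreover have "M \<inter> N = {}" using MN by fastforce
        then have "card (M \<union> N) = nu A + nu (V - A)"
          using M(2) N(2) matching_finite[OF finAB(1) M(1)] matching_finite[OF finAB(2) N(1)]
          by (simp add: card_Un_disjoint)
        ultimately have nu: "nu A + nu (V - A) \<le> nu V" using nu_ge[OF fin] by metis
        have "model (A \<union> (V - A)) ((card A - nu A) + (card (V - A) - nu (V - A)))"
          using no by (intro model_Un IH AV BV) auto
        moreover have "A \<union> (V - A) = V" using AV by blast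
        moreover have "card A + card (V - A) = card V"
          using AV finAB(1) card_mono[OF fin, of A] by (simp add: card_Diff_subset psubset_imp_subset)
        ultimately show ?thesis
          using nu nu_le[OF finAB(1)] nu_le[OF finAB(2)] by (auto elim!: model_le)
      qed
    qed
  qed
qed

end

section \<open>Translation to graphs\<close>

lemma connected_singleton:
  assumes "v \<in> pverts G"
  shows "Digraph_Component.connected (with_proj G \<restriction> {v})"
  unfolding Digraph_Component.connected_def strongly_connected_def
  using assms by (auto simp: reachable_def)

lemma connected_path:
  assumes "(a, b) \<in> parcs G" "(b, c) \<in> parcs G"
  shows "Digraph_Component.connected (with_proj G \<restriction> {a, c, b})"
proof -
  let ?S = "with_proj (mk_symmetric (with_proj G \<restriction> {a, c, b}))"
  have arcs: "(a, b) \<in> arcs_ends ?S" "(b, a) \<in> arcs_ends ?S" "(b, c) \<in> arcs_ends ?S" "(c, b) \<in> arcs_ends ?S"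
    using assms by (force simp: parcs_mk_symmetric)+
  have verts: "verts ?S = {a, c, b}" by simp
  have r1: "u \<rightarrow>\<^sup>*\<^bsub>?S\<^esub> u" if "u \<in> {a, c, b}" for u
    using that unfolding reachable_def verts by simp
  have r2: "u \<rightarrow>\<^sup>*\<^bsub>?S\<^esub> v" if "u \<in> {a, c, b}" "v \<in> {a, c, b}" "(u, v) \<in> arcs_ends ?S" for u v
    using that unfolding reachable_def verts by (meson rtrancl_on.intros)
  have r3: "u \<rightarrow>\<^sup>*\<^bsub>?S\<^esub> w" if "u \<in> {a, c, b}" "v \<in> {a, c, b}" "w \<in> {a, c, b}"
    "(u, v) \<in> arcs_ends ?S" "(v, w) \<in> arcs_ends ?S" for u v w
    using that unfolding reachable_def verts by (meson rtrancl_on.intros)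
  have "u \<rightarrow>\<^sup>*\<^bsub>?S\<^esub> v" if "u \<in> {a, c, b}" "v \<in> {a, c, b}" for u v
  proof -
    have "a \<rightarrow>\<^sup>*\<^bsub>?S\<^esub> c" by (rule r3[of a b c]) (use arcs in simp_all)
    moreover have "c \<rightarrow>\<^sup>*\<^bsub>?S\<^esub> a" by (rule r3[of c b a]) (use arcs in simp_all)
    moreover have "a \<rightarrow>\<^sup>*\<^bsub>?S\<^esub> b" by (rule r2) (use arcs in simp_all)
    moreover have "b \<rightarrow>\<^sup>*\<^bsub>?S\<^esub> a" by (rule r2) (use arcs in simp_all)
    moreover have "c \<rightarrow>\<^sup>*\<^bsub>?S\<^esub> b" by (rule r2) (use arcs in simp_all)
    moreover have "b \<rightarrow>\<^sup>*\<^bsub>?S\<^esub> c" by (rule r2) (use arcs in simp_all)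
    ultimately show ?thesis using that r1 by (elim insertE emptyE) simp_all
  qed
  then show ?thesis
    unfolding Digraph_Component.connected_def strongly_connected_def by simp
qed

text \<open>\<open>Max\<close> is informative only on a finite set: choosing a vertex in each branch
  set bounds the order of a clique minor by the number of vertices.\<close>

lemma minor_le_hadwiger:
  assumes fin: "finite (pverts G)" and minor: "is_minor (complete_graph s) G"
  shows "s \<le> hadwiger_number G"
proof -
  have "r \<le> card (pverts G)" if r: "is_minor (complete_graph r) G" for r
  proof -
    obtain B where B: "\<And>x. x < r \<Longrightarrow> B x \<subseteq> pverts G \<and> Digraph_Component.connected (with_proj G \<restriction> B x)"
      and dis: "disjoint_family_on B {..<r}"
      using r unfolding is_minor_def complete_graph_def by auto
    have "\<exists>v. v \<in> B x" if "x < r" for x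
      using B[OF that] unfolding Digraph_Component.connected_def strongly_connected_def by auto
    then obtain f where f: "\<And>x. x < r \<Longrightarrow> f x \<in> B x" by metis
    have "inj_on f {..<r}"
      using f dis unfolding disjoint_family_on_def by (intro inj_onI) (metis IntI empty_iff lessThan_iff)
    moreover have "f ` {..<r} \<subseteq> pverts G" using f B by blast
    ultimately show ?thesis using card_inj_on_le[of f "{..<r}"] fin by simp
  qed
  then have "finite {r. is_minor (complete_graph r) G}"
    by (intro finite_subset[OF _ finite_atMost[of "card (pverts G)"]]) auto
  then show ?thesis unfolding hadwiger_number_def using minor by (intro Max_ge) auto
qed

lemma independent_card_le:
  assumes "finite (pverts G)" "independent_set G S"
  shows "card S \<le> independence_number G"
proof -
  have "finite {card S | S. independent_set G S}"
    by (rule finite_subset[of _ "card ` Pow (pverts G)"])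
      (use assms(1) in \<open>auto simp: independent_set_def\<close>)
  then show ?thesis unfolding independence_number_def using assms(2) by (intro Max_ge) auto
qed

lemma ex_b_fold_colouring:
  assumes fin: "finite (pverts G)" and loopfree: "\<And>v. (v, v) \<notin> parcs G"
    and arcs: "parcs G \<subseteq> pverts G \<times> pverts G"
  shows "\<exists>k F. b_fold_colouring G b k F"
proof -
  obtain h :: "'a \<Rightarrow> nat" where h: "inj_on h (pverts G)" "h ` pverts G = {..<card (pverts G)}"
    using ex_bij_betw_finite_nat[OF fin] by (auto simp: bij_betw_def atLeast0LessThan)
  \<comment> \<open>Disjoint blocks of \<open>b\<close> colours. Some colouring must exist before
    the \<open>LEAST\<close> in \<open>b_fold_chromatic_number\<close> can be known to be
    attained.\<close>
  define F where "F v = (\<lambda>i. h v * b + i) ` {..<b}" for v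
  have "card (F v) = b" for v by (simp add: F_def card_image inj_on_def)
  moreover have "F v \<subseteq> {..<card (pverts G) * b}" if "v \<in> pverts G" for v
  proof
    fix x assume "x \<in> F v"
    then obtain i where i: "i < b" "x = h v * b + i" by (auto simp: F_def)
    have "h v < card (pverts G)" using h(2) that by blast
    then have "Suc (h v) * b \<le> card (pverts G) * b" by (intro mult_le_mono1) simp
    then show "x \<in> {..<card (pverts G) * b}" using i by simp
  qed
  moreover have "F u \<inter> F v = {}" if "(u, v) \<in> parcs G" for u v
  proof (rule ccontr)
    assume "F u \<inter> F v \<noteq> {}"
    then obtain i j where ij: "i < b" "j < b" "h u * b + i = h v * b + j" by (auto simp: F_def)
    have "h u = (h u * b + i) div b" using ij(1) by simp
    also have "\<dots> = (h v * b + j) div b" by (simp only: ij(3))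
    also have "\<dots> = h v" using ij(2) by simp
    finally have "h u = h v" .
    then have "u = v" using h(1) that arcs by (auto dest: inj_onD)
    then show False using that loopfree by simp
  qed
  ultimately show ?thesis unfolding b_fold_colouring_def by blast
qed

text \<open>A \<open>b\<close>-fold colouring of the complement with \<open>k\<close> colours consists of \<open>k\<close> cliques covering
  each vertex \<open>b\<close> times; one of them has at least average weight.\<close>

lemma heavy_clique:
  fixes c :: "'a \<Rightarrow> nat"
  assumes G: "pair_graph G" and theta: "fractional_clique_covering_number G \<le> r"
  obtains K where "K \<subseteq> pverts G" "\<And>x y. x \<in> K \<Longrightarrow> y \<in> K \<Longrightarrow> x \<noteq> y \<Longrightarrow> (x, y) \<in> parcs G"
    "real (\<Sum>x\<in>pverts G. c x) \<le> r * real (\<Sum>x\<in>K. c x)"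
proof -
  interpret pair_graph G by (rule G)
  let ?V = "pverts G" and ?H = "complement_graph G"
  have fin: "finite ?V" by simp
  define clique where
    "clique K \<longleftrightarrow> K \<subseteq> ?V \<and> (\<forall>x\<in>K. \<forall>y\<in>K. x \<noteq> y \<longrightarrow> (x, y) \<in> parcs G)" for K
  define n where "n = (\<Sum>x\<in>?V. c x)"
  define w where "w = Max ((\<lambda>K. \<Sum>x\<in>K. c x) ` {K. clique K})"
  have fc: "finite {K. clique K}"
    by (rule finite_subset[of _ "Pow ?V"]) (use fin in \<open>auto simp: clique_def\<close>)
  have "clique {}" by (simp add: clique_def)
  then have "w \<in> (\<lambda>K. \<Sum>x\<in>K. c x) ` {K. clique K}"
    unfolding w_def using fc by (intro Max_in) auto
  then obtain K where K: "clique K" "w = (\<Sum>x\<in>K. c x)" by auto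
  have w: "(\<Sum>x\<in>K. c x) \<le> w" if "clique K" for K
    unfolding w_def using fc that by (intro Max_ge) auto
  have main: "real n \<le> (real (b_fold_chromatic_number b ?H) / real b) * real w" if b: "1 \<le> b" for b
  proof -
    have "\<exists>k F. b_fold_colouring ?H b k F"
      by (rule ex_b_fold_colouring) (auto simp: complement_graph_def)
    then have "\<exists>F. b_fold_colouring ?H b (b_fold_chromatic_number b ?H) F"
      unfolding b_fold_chromatic_number_def by (rule LeastI_ex)
    then obtain F where F: "b_fold_colouring ?H b (b_fold_chromatic_number b ?H) F" by blast
    define k where "k = b_fold_chromatic_number b ?H"
    have Fv: "F v \<subseteq> {..<k}" "card (F v) = b" if "v \<in> ?V" for v
      using F that by (auto simp: b_fold_colouring_def complement_graph_def k_def)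
    have col: "clique {x \<in> ?V. i \<in> F x}" for i
      unfolding clique_def
    proof (intro conjI ballI impI)
      fix x y assume "x \<in> {x \<in> ?V. i \<in> F x}" "y \<in> {x \<in> ?V. i \<in> F x}" "x \<noteq> y"
      then have xy: "x \<in> ?V" "y \<in> ?V" "x \<noteq> y" "i \<in> F x \<inter> F y" by auto
      show "(x, y) \<in> parcs G"
      proof (rule ccontr)
        assume "(x, y) \<notin> parcs G"
        then have "(x, y) \<in> parcs ?H" using xy by (simp add: complement_graph_def)
        then have "F x \<inter> F y = {}" using F by (auto simp: b_fold_colouring_def)
        then show False using xy(4) by simp
      qed
    qed auto
    have "b * n = (\<Sum>x\<in>?V. \<Sum>i<k. if i \<in> F x then c x else 0)"
    proof -
      have "(\<Sum>i<k. if i \<in> F x then c x else 0) = b * c x" if "x \<in> ?V" for x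
      proof -
        have "{..<k} \<inter> F x = F x" using Fv(1)[OF that] by blast
        then show ?thesis using Fv(2)[OF that] by (simp add: sum.If_cases)
      qed
      then show ?thesis by (simp add: n_def sum_distrib_left)
    qed
    also have "\<dots> = (\<Sum>i<k. \<Sum>x\<in>?V. if i \<in> F x then c x else 0)" by (rule sum.swap)
    also have "\<dots> = (\<Sum>i<k. \<Sum>x\<in>{x \<in> ?V. i \<in> F x}. c x)"
      by (simp add: sum.inter_filter[OF fin])
    also have "\<dots> \<le> (\<Sum>i<k. w)" by (intro sum_mono w col)
    finally have "b * n \<le> k * w" by simp
    then have "real (b * n) \<le> real (k * w)" by (simp only: of_nat_le_iff)
    then show ?thesis using b by (simp add: k_def field_simps)
  qed
  have "real n \<le> r * real w"
  proof (cases "w = 0")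
    case True
    then show ?thesis using main[of 1] by simp
  next
    case False
    \<comment> \<open>This quotient is a lower bound for every ratio in the infimum, so it is
      irrelevant whether the infimum is attained.\<close>
    have "real n / real w \<le> fractional_clique_covering_number G"
      unfolding fractional_clique_covering_number_def fractional_chromatic_number_def
    proof (rule cINF_greatest)
      fix b :: nat assume "b \<in> {1..}"
      then show "real n / real w \<le> real (b_fold_chromatic_number b ?H) / real b"
        using main[of b] False by (simp add: pos_divide_le_eq)
    qed simp
    then have "real n / real w \<le> r" using theta by linarith
    then show ?thesis using False by (simp add: pos_divide_le_eq)
  qed
  then show thesis
    using that[of K] K unfolding clique_def n_def by blast
qed

text \<open>Confined to vertices because \<open>triangle_free\<close> speaks about the whole type,
  where any three distinct elements outside the graph would otherwise form a triangle.\<close>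

definition nonadjacent :: "'a pair_pre_digraph \<Rightarrow> 'a \<Rightarrow> 'a \<Rightarrow> bool" where
  "nonadjacent G u v \<longleftrightarrow> u \<in> pverts G \<and> v \<in> pverts G \<and> u \<noteq> v \<and> (u, v) \<notin> parcs G"

lemma nonadjacent_triangle_free:
  assumes fin: "finite (pverts G)" and sym: "\<And>u v. (u, v) \<in> parcs G \<Longrightarrow> (v, u) \<in> parcs G"
    and loopfree: "\<And>v. (v, v) \<notin> parcs G" and alpha: "independence_number G \<le> 2"
  shows "triangle_free (nonadjacent G)"
proof
  show s: "nonadjacent G u v \<Longrightarrow> nonadjacent G v u" for u v
    using sym by (auto simp: nonadjacent_def)
  show "\<not> nonadjacent G u u" for u by (simp add: nonadjacent_def)
  show "\<not> nonadjacent G u w" if uv: "nonadjacent G u v" "nonadjacent G v w" for u v w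
  proof
    assume uw: "nonadjacent G u w"
    have "independent_set G {u, v, w}"
      using uv uw s[OF uv(1)] s[OF uv(2)] s[OF uw] loopfree
      by (simp add: independent_set_def nonadjacent_def)
    from independent_card_le[OF fin this] show False
      using uv uw alpha by (simp add: nonadjacent_def card_insert_if)
  qed
qed

lemma matching_colouring:
  assumes tf: "triangle_free (nonadjacent G)" and fin: "finite (pverts G)"
    and arcs: "parcs G \<subseteq> pverts G \<times> pverts G" and loopfree: "\<And>v. (v, v) \<notin> parcs G"
  shows "chromatic_number G \<le> card (pverts G) - triangle_free.nu (nonadjacent G) (pverts G)"
proof -
  interpret triangle_free "nonadjacent G" by (rule tf)
  let ?V = "pverts G"
  obtain M where M: "matching ?V M" "card M = nu ?V" using nu_attained[OF fin] by blast
  \<comment> \<open>The colour classes: \<open>nu\<close> matched pairs and the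
    \<open>n - 2 * nu\<close> vertices left uncovered, where \<open>n\<close> is the order of the
    graph.\<close>
  define P where "P = M \<union> (\<lambda>v. {v}) ` (?V - \<Union>M)"
  have finM: "finite M" by (rule matching_finite[OF fin M(1)])
  have finP: "finite P" using finM fin by (simp add: P_def)
  have MV: "\<Union>M \<subseteq> ?V" by (rule matching_Union[OF M(1)])
  have "card P \<le> card M + card (?V - \<Union>M)"
    unfolding P_def using card_Un_le card_image_le[of "?V - \<Union>M" "\<lambda>v. {v}"] fin
    by (meson add_left_mono finite_Diff le_trans)
  also have "card (?V - \<Union>M) = card ?V - 2 * card M"
    using card_matching[OF fin M(1)] MV fin finite_subset by (metis card_Diff_subset)
  finally have cP: "card P \<le> card ?V - nu ?V" using M(2) nu_le[OF fin] by simp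
  obtain h where h: "bij_betw h P {0..<card P}" using ex_bij_betw_finite_nat[OF finP] by blast
  have "\<exists>e. e \<in> P \<and> v \<in> e" if "v \<in> ?V" for v using that by (auto simp: P_def)
  then obtain p where p: "\<And>v. v \<in> ?V \<Longrightarrow> p v \<in> P \<and> v \<in> p v" by metis
  have "proper_colouring G (card P) (\<lambda>v. h (p v))"
    unfolding proper_colouring_def
  proof (intro conjI ballI)
    fix v assume "v \<in> ?V"
    then show "h (p v) < card P" using p h by (auto simp: bij_betw_def)
  next
    fix a assume "a \<in> parcs G"
    then obtain u v where a: "a = (u, v)" "(u, v) \<in> parcs G" by (cases a) simp
    have uv: "u \<in> ?V" "v \<in> ?V" "u \<noteq> v" using a(2) arcs loopfree by auto
    have "h (p u) \<noteq> h (p v)"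
    proof
      assume "h (p u) = h (p v)"
      then have eq: "p u = p v" using p uv h by (auto simp: bij_betw_def inj_on_def)
      have e: "p u \<in> P" "u \<in> p u" "v \<in> p u" using p[OF uv(1)] p[OF uv(2)] eq by auto
      then have "p u \<in> M" using uv(3) by (auto simp: P_def)
      then have "p u \<in> edges ?V" using M(1) by (auto simp: matching_def)
      then obtain x y where "p u = {x, y}" "nonadjacent G x y" by (auto simp: edges_def)
      then have "nonadjacent G u v" using e uv(3) commute by auto
      then show False using a(2) by (simp add: nonadjacent_def)
    qed
    then show "case a of (u, v) \<Rightarrow> h (p u) \<noteq> h (p v)" using a by simp
  qed
  then have "chromatic_number G \<le> card P" unfolding chromatic_number_def by (intro Least_le) blast
  then show ?thesis using cP by simp
qed

lemma model_minor:
  assumes tf: "triangle_free (nonadjacent G)"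
    and m: "triangle_free.model (nonadjacent G) (pverts G) s"
    and arc_sym: "\<And>u v. (u, v) \<in> parcs G \<Longrightarrow> (v, u) \<in> parcs G"
  shows "is_minor (complete_graph s) G"
proof -
  interpret triangle_free "nonadjacent G" by (rule tf)
  obtain F where F: "finite F" "card F = s" "\<And>B. B \<in> F \<Longrightarrow> branch B \<and> B \<subseteq> pverts G"
    "\<And>A B. A \<in> F \<Longrightarrow> B \<in> F \<Longrightarrow> A \<noteq> B \<Longrightarrow> A \<inter> B = {} \<and> joined A B"
    using modelE[OF m] by metis
  obtain B where B: "bij_betw B {..<s} F"
    using ex_bij_betw_nat_finite[OF F(1)] F(2) by (auto simp: atLeast0LessThan)
  have BF: "B x \<in> F" if "x < s" for x using B that by (auto simp: bij_betw_def)
  have ne: "B x \<noteq> B y" if "x < s" "y < s" "x \<noteq> y" for x y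
    using B that by (auto simp: bij_betw_def inj_on_def)
  have conn: "Digraph_Component.connected (with_proj G \<restriction> C)" if C: "C \<in> F" for C
  proof -
    have sub: "C \<subseteq> pverts G" and br: "branch C" using F(3)[OF C] by auto
    from br consider v where "C = {v}" | a c b where "gull a c b" "C = {a, c, b}"
      by (auto simp: branch_def)
    then show ?thesis
    proof cases
      case 1
      then show ?thesis using connected_singleton[of v G] sub by simp
    next
      case 2
      then have "(a, b) \<in> parcs G" and "(c, b) \<in> parcs G"
        using sub by (auto simp: gull_def nonadjacent_def)
      then show ?thesis unfolding 2(2) using connected_path arc_sym by metis
    qed
  qed
  have arc: "\<exists>u\<in>B x. \<exists>v\<in>B y. (u, v) \<in> parcs G" if xy: "x < s" "y < s" "x \<noteq> y" for x y
  proof -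
    have "joined (B x) (B y)" using F(4)[OF BF[OF xy(1)] BF[OF xy(2)] ne[OF xy]] by simp
    then obtain u v where uv: "u \<in> B x" "v \<in> B y" "u \<noteq> v" "\<not> nonadjacent G u v"
      by (auto simp: joined_def)
    have "u \<in> pverts G" "v \<in> pverts G" using uv F(3)[OF BF[OF xy(1)]] F(3)[OF BF[OF xy(2)]] by auto
    then have "(u, v) \<in> parcs G" using uv by (simp add: nonadjacent_def)
    then show ?thesis using uv(1,2) by blast
  qed
  have "disjoint_family_on B {..<s}"
    using F(4) BF ne unfolding disjoint_family_on_def by simp
  then show ?thesis
    unfolding is_minor_def using F(3) BF conn arc
    by (intro exI[of _ B]) (auto simp: complete_graph_def)
qed

theorem theorem2p30:
  fixes G :: "'a pair_pre_digraph" and G' :: "'b pair_pre_digraph"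
  assumes "pair_graph G"
    and "independence_number G = 2"
    and "fractional_clique_covering_number G \<le> 124 / 33"
    and "is_inflation G G'"
    and "independence_number G' = 2"
  shows "hadwiger_number G' \<ge> chromatic_number G'"
proof -
  interpret G: pair_graph G by (rule assms(1))
  obtain C where infl: "(\<forall>x\<in>pverts G. finite (C x)) \<and> disjoint_family_on C (pverts G) \<and>
      pverts G' = (\<Union>x\<in>pverts G. C x) \<and>
      parcs G' = {(u, v). \<exists>x\<in>pverts G. \<exists>y\<in>pverts G. u \<in> C x \<and> v \<in> C y \<and>
        (x = y \<and> u \<noteq> v \<or> (x, y) \<in> parcs G)}"
    using assms(4) unfolding is_inflation_def by (elim exE)
  then have C: "\<And>x. x \<in> pverts G \<Longrightarrow> finite (C x)" "disjoint_family_on C (pverts G)"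
    "pverts G' = (\<Union>x\<in>pverts G. C x)"
    and arcs: "parcs G' = {(u, v). \<exists>x\<in>pverts G. \<exists>y\<in>pverts G. u \<in> C x \<and> v \<in> C y \<and>
        (x = y \<and> u \<noteq> v \<or> (x, y) \<in> parcs G)}"
    by simp_all
  have fin: "finite (pverts G')" using C(1,3) G.pair_finite_verts by simp
  have unique: "x = y" if "x \<in> pverts G" "y \<in> pverts G" "u \<in> C x" "u \<in> C y" for x y u
    using C(2) that unfolding disjoint_family_on_def by blast
  have arc_sym: "(v, u) \<in> parcs G'" if "(u, v) \<in> parcs G'" for u v
    using that G.arcs_symmetric unfolding arcs by blast
  have loopfree: "(v, v) \<notin> parcs G'" for v
    using unique G.no_loops' unfolding arcs by fastforce
  have sub: "parcs G' \<subseteq> pverts G' \<times> pverts G'" unfolding arcs C(3) by blast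
  have tf: "triangle_free (nonadjacent G')"
    using nonadjacent_triangle_free[OF fin arc_sym loopfree] assms(5) by simp
  interpret triangle_free "nonadjacent G'" by (rule tf)
  have "\<exists>Z\<subseteq>U. stable Z \<and> 33 * card U \<le> 124 * card Z" if U: "U \<subseteq> pverts G'" for U
  proof -
    \<comment> \<open>\<open>U\<close> induces an inflation of \<open>G\<close> with these clique
      orders, some possibly zero. A clique of \<open>G\<close> that is heavy for these weights
      expands to a large clique inside \<open>U\<close>.\<close>
    define c where "c x = card (U \<inter> C x)" for x
    obtain K where K: "K \<subseteq> pverts G" "\<And>x y. x \<in> K \<Longrightarrow> y \<in> K \<Longrightarrow> x \<noteq> y \<Longrightarrow> (x, y) \<in> parcs G"
      and le: "real (\<Sum>x\<in>pverts G. c x) \<le> 124 / 33 * real (\<Sum>x\<in>K. c x)"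
      using heavy_clique[OF assms(1,3), of c] by blast
    have count: "card (U \<inter> (\<Union>x\<in>A. C x)) = (\<Sum>x\<in>A. c x)" if A: "A \<subseteq> pverts G" for A
    proof -
      have "card (\<Union>x\<in>A. U \<inter> C x) = (\<Sum>x\<in>A. card (U \<inter> C x))"
      proof (rule card_UN_disjoint)
        show "finite A" using A G.pair_finite_verts finite_subset by blast
        show "\<forall>x\<in>A. finite (U \<inter> C x)" using C(1) A by (simp add: subset_iff)
        have "(U \<inter> C x) \<inter> (U \<inter> C y) = {}" if "x \<in> A" "y \<in> A" "x \<noteq> y" for x y
          using unique[of x y] that A by blast
        then show "\<forall>x\<in>A. \<forall>y\<in>A. x \<noteq> y \<longrightarrow> (U \<inter> C x) \<inter> (U \<inter> C y) = {}" by simp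
      qed
      then show ?thesis by (simp only: Int_UN_distrib c_def)
    qed
    define Z where "Z = U \<inter> (\<Union>x\<in>K. C x)"
    have "stable Z"
      unfolding stable_def
    proof (intro ballI)
      fix u v assume "u \<in> Z" "v \<in> Z"
      then obtain x y where "x \<in> K" "y \<in> K" "u \<in> C x" "v \<in> C y" by (auto simp: Z_def)
      then show "\<not> nonadjacent G' u v"
        using K unfolding nonadjacent_def arcs by blast
    qed
    moreover have "U \<inter> (\<Union>x\<in>pverts G. C x) = U" using U C(3) by blast
    then have "real (card U) \<le> 124 / 33 * real (card Z)"
      using le count[OF K(1)] count[OF order_refl] by (simp add: Z_def)
    then have "33 * card U \<le> 124 * card Z" by linarith
    ultimately show ?thesis by (intro exI[of _ Z]) (auto simp: Z_def)
  qed
  then have "model (pverts G') (card (pverts G') - nu (pverts G'))"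
    by (rule clique_model[OF fin])
  then have "card (pverts G') - nu (pverts G') \<le> hadwiger_number G'"
    by (rule minor_le_hadwiger[OF fin model_minor[OF tf _ arc_sym]])
  then show ?thesis using matching_colouring[OF tf fin sub loopfree] by simp
qed

end
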